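(* Let $C$ be a coalgebra over a field $k$, with dual algebra $C^*$. Suppose that for every right $C^*$-module $M$ the rational part $\mathrm{Rat}(M)$ is a direct summand of $M$ as a right $C^*$-module. Then $C$ is finite dimensional over $k$.
   Context: For a coalgebra $C$ over a field $k$ (coassociative, counital) with $\Delta(c)=c_1\otimes c_2$ (Sweedler notation) and counit $\varepsilon$, the dual algebra $C^*=\mathrm{Hom}_k(C,k)$ has the convolution product $(fg)(c)=f(c_1)g(c_2)$ and unit $\varepsilon$. For a right $C^*$-module $M$, an element $m\in M$ is called rational if there are finitely many $m_i\in M$ and $c_i\in C$ such that $m\cdot f=\sum_i f(c_i)m_i$ for all $f\in C^*$. The rational part $\mathrm{Rat}(M)$ is the set of all rational elements; it is a submodule, namely the largest submodule of $M$ whose $C^*$-module structure comes from a left $C$-comodule structure. Saying that the rational part of $M$ "splits off" means that $\mathrm{Rat}(M)$ is a direct summand of $M$ as a right $C^*$-module. *)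

theory Defs
  imports Complex_Main "HOL-Algebra.AbelCoset" "HOL-Library.Poly_Mapping"
begin

section \<open>Tensor powers of a vector space\<close>

text \<open>
  The free vector space on a type \<open>'x\<close> is \<open>'x \<Rightarrow>\<^sub>0 'k\<close>; the basis vector belonging to \<open>p\<close> is
  \<open>single p 1\<close>.
\<close>

definition free_scale :: "'k::field \<Rightarrow> ('x \<Rightarrow>\<^sub>0 'k) \<Rightarrow> 'x \<Rightarrow>\<^sub>0 'k" where
  "free_scale r x = Poly_Mapping.map ((*) r) x"

definition basis_vec :: "'x \<Rightarrow> 'x \<Rightarrow>\<^sub>0 'k::field" where
  "basis_vec p = Poly_Mapping.single p 1"

text \<open>
  The linear extension of \<open>\<phi>\<close> to the free vector space; \<open>s\<close> is the scalar multiplication of the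
  target space.
\<close>

definition lin_ext :: "('k::field \<Rightarrow> 'v \<Rightarrow> 'v) \<Rightarrow> ('x \<Rightarrow> 'v::ab_group_add) \<Rightarrow> ('x \<Rightarrow>\<^sub>0 'k) \<Rightarrow> 'v" where
  "lin_ext s \<phi> x = (\<Sum>p\<in>Poly_Mapping.keys x. s (Poly_Mapping.lookup x p) (\<phi> p))"

text \<open>
  A tensor power of \<open>C\<close> is the free vector space on tuples modulo the subspace spanned by the
  multilinearity relations.  The set \<open>J\<close> of slots consists of the maps that insert a vector into
  one position of a tuple whose other entries are fixed, so that the relations express
  additivity and homogeneity in each position.
\<close>

definition slots2 :: "('c \<Rightarrow> 'c \<times> 'c) set" where
  "slots2 = range (\<lambda>b a. (a, b)) \<union> range (\<lambda>a b. (a, b))"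

definition slots3 :: "('c \<Rightarrow> 'c \<times> 'c \<times> 'c) set" where
  "slots3 = {\<lambda>a. (a, b, c) | b c. True} \<union> {\<lambda>b. (a, b, c) | a c. True}
     \<union> {\<lambda>c. (a, b, c) | a b. True}"

definition multilinear_relations ::
    "('k::field \<Rightarrow> 'c::ab_group_add \<Rightarrow> 'c) \<Rightarrow> ('c \<Rightarrow> 'x) set \<Rightarrow> ('x \<Rightarrow>\<^sub>0 'k) set" where
  "multilinear_relations scale J = module.span free_scale
     (\<Union>j\<in>J. {basis_vec (j (a + b)) - basis_vec (j a) - basis_vec (j b) | a b. True}
         \<union> {basis_vec (j (scale r a)) - free_scale r (basis_vec (j a)) | r a. True})"

definition tensor_class ::
    "('k::field \<Rightarrow> 'c::ab_group_add \<Rightarrow> 'c) \<Rightarrow> ('c \<Rightarrow> 'x) set \<Rightarrow> ('x \<Rightarrow>\<^sub>0 'k) \<Rightarrow> ('x \<Rightarrow>\<^sub>0 'k) set" where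
  "tensor_class scale J x = {y. y - x \<in> multilinear_relations scale J}"

definition tensor_square ::
    "('k::field \<Rightarrow> 'c::ab_group_add \<Rightarrow> 'c) \<Rightarrow> ('c \<times> 'c \<Rightarrow>\<^sub>0 'k) set set" where
  "tensor_square scale = range (tensor_class scale slots2)"

text \<open>
  Sweedler notation: a formal sum \<open>c\<^sub>1 \<otimes> c\<^sub>2\<close> representing a given tensor.  It is only ever
  plugged into bilinear expressions (up to the multilinearity relations), so that the choice
  of the representative is irrelevant.
\<close>

definition sweedler :: "('x \<Rightarrow>\<^sub>0 'k::field) set \<Rightarrow> 'x \<Rightarrow>\<^sub>0 'k" where
  "sweedler t = (SOME x. x \<in> t)"


section \<open>Coalgebras\<close>

text \<open>
  The assumptions \<open>comult_add\<close> and \<open>comult_scale\<close> are linearity of \<open>\<Delta>\<close>, formulated with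
  representatives of the cosets.  Coassociativity is the equality of \<open>(\<Delta> \<otimes> id) (\<Delta> c)\<close> and
  \<open>(id \<otimes> \<Delta>) (\<Delta> c)\<close> in \<open>C \<otimes> C \<otimes> C\<close>.
\<close>

locale coalgebra = vector_space scale
  for scale :: "'k::field \<Rightarrow> 'c::ab_group_add \<Rightarrow> 'c" +
  fixes \<Delta> :: "'c \<Rightarrow> ('c \<times> 'c \<Rightarrow>\<^sub>0 'k) set"
    and \<epsilon> :: "'c \<Rightarrow> 'k"
  assumes comult_tensor: "\<Delta> c \<in> tensor_square scale"
    and comult_add: "x \<in> \<Delta> a \<Longrightarrow> y \<in> \<Delta> b \<Longrightarrow> x + y \<in> \<Delta> (a + b)"
    and comult_scale: "x \<in> \<Delta> a \<Longrightarrow> free_scale r x \<in> \<Delta> (scale r a)"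
    and counit_linear: "Vector_Spaces.linear scale (*) \<epsilon>"
    and coassoc:
      "tensor_class scale slots3
         (lin_ext free_scale
           (\<lambda>(a, b). lin_ext free_scale (\<lambda>(u, v). basis_vec (u, v, b)) (sweedler (\<Delta> a)))
           (sweedler (\<Delta> c)))
       = tensor_class scale slots3
         (lin_ext free_scale
           (\<lambda>(a, b). lin_ext free_scale (\<lambda>(u, v). basis_vec (a, u, v)) (sweedler (\<Delta> b)))
           (sweedler (\<Delta> c)))"
    and counit_left: "lin_ext scale (\<lambda>(a, b). scale (\<epsilon> a) b) (sweedler (\<Delta> c)) = c"
    and counit_right: "lin_ext scale (\<lambda>(a, b). scale (\<epsilon> b) a) (sweedler (\<Delta> c)) = c"

definition convolution ::
    "('c \<Rightarrow> ('c \<times> 'c \<Rightarrow>\<^sub>0 'k::field) set) \<Rightarrow> ('c \<Rightarrow> 'k) \<Rightarrow> ('c \<Rightarrow> 'k) \<Rightarrow> 'c \<Rightarrow> 'k" where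
  "convolution \<Delta> f g c = lin_ext (*) (\<lambda>(a, b). f a * g b) (sweedler (\<Delta> c))"

definition dual_algebra ::
    "('k::field \<Rightarrow> 'c::ab_group_add \<Rightarrow> 'c) \<Rightarrow> ('c \<Rightarrow> ('c \<times> 'c \<Rightarrow>\<^sub>0 'k) set) \<Rightarrow> ('c \<Rightarrow> 'k)
       \<Rightarrow> ('c \<Rightarrow> 'k) ring" where
  "dual_algebra scale \<Delta> \<epsilon> =
     \<lparr>carrier = {f. Vector_Spaces.linear scale (*) f},
      monoid.mult = convolution \<Delta>,
      one = \<epsilon>,
      zero = (\<lambda>c. 0),
      add = (\<lambda>f g c. f c + g c)\<rparr>"


section \<open>Right modules\<close>

text \<open>
  HOL-Algebra has modules over commutative rings only.  As there, the record extends that of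
  rings, but the multiplicative part of \<open>M\<close> is not used.

  A statement about all right \<open>C\<^sup>*\<close>-modules has to name a type for their carriers.  The type
  \<open>(('c \<Rightarrow> 'k) \<Rightarrow> 'c \<Rightarrow> 'k) set\<close> contains the cosets of every submodule of a product of copies
  of \<open>C\<^sup>*\<close> indexed by \<open>C\<^sup>*\<close>; hence every right \<open>C\<^sup>*\<close>-module with a generating set of cardinality
  at most that of \<open>C\<^sup>*\<close> has an isomorphic copy carried by this type.
\<close>

record ('r, 'm) right_mod = "'m ring" +
  ract :: "'m \<Rightarrow> 'r \<Rightarrow> 'm"  (infixl \<open>\<cdot>\<index>\<close> 70)

locale right_module = R?: ring R + M?: abelian_group M
  for R :: "('r, 'p) ring_scheme" (structure)
    and M :: "('r, 'm, 'q) right_mod_scheme" (structure) +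
  assumes ract_closed: "x \<in> carrier M \<Longrightarrow> a \<in> carrier R \<Longrightarrow> x \<cdot>\<^bsub>M\<^esub> a \<in> carrier M"
    and ract_add_left: "x \<in> carrier M \<Longrightarrow> y \<in> carrier M \<Longrightarrow> a \<in> carrier R \<Longrightarrow>
          (x \<oplus>\<^bsub>M\<^esub> y) \<cdot>\<^bsub>M\<^esub> a = x \<cdot>\<^bsub>M\<^esub> a \<oplus>\<^bsub>M\<^esub> y \<cdot>\<^bsub>M\<^esub> a"
    and ract_add_right: "x \<in> carrier M \<Longrightarrow> a \<in> carrier R \<Longrightarrow> b \<in> carrier R \<Longrightarrow>
          x \<cdot>\<^bsub>M\<^esub> (a \<oplus>\<^bsub>R\<^esub> b) = x \<cdot>\<^bsub>M\<^esub> a \<oplus>\<^bsub>M\<^esub> x \<cdot>\<^bsub>M\<^esub> b"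
    and ract_mult: "x \<in> carrier M \<Longrightarrow> a \<in> carrier R \<Longrightarrow> b \<in> carrier R \<Longrightarrow>
          x \<cdot>\<^bsub>M\<^esub> (a \<otimes>\<^bsub>R\<^esub> b) = (x \<cdot>\<^bsub>M\<^esub> a) \<cdot>\<^bsub>M\<^esub> b"
    and ract_one: "x \<in> carrier M \<Longrightarrow> x \<cdot>\<^bsub>M\<^esub> \<one>\<^bsub>R\<^esub> = x"

definition right_submodule ::
    "('r, 'p) ring_scheme \<Rightarrow> ('r, 'm, 'q) right_mod_scheme \<Rightarrow> 'm set \<Rightarrow> bool" where
  "right_submodule R M N \<longleftrightarrow> subgroup N (add_monoid M) \<and>
     (\<forall>x\<in>N. \<forall>a\<in>carrier R. x \<cdot>\<^bsub>M\<^esub> a \<in> N)"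

definition direct_summand ::
    "('r, 'p) ring_scheme \<Rightarrow> ('r, 'm, 'q) right_mod_scheme \<Rightarrow> 'm set \<Rightarrow> bool" where
  "direct_summand R M N \<longleftrightarrow> right_submodule R M N \<and>
     (\<exists>P. right_submodule R M P \<and> N \<inter> P = {\<zero>\<^bsub>M\<^esub>} \<and> N <+>\<^bsub>M\<^esub> P = carrier M)"

text \<open>
  The scalar \<open>r\<close> acts on a right \<open>C\<^sup>*\<close>-module as the element \<open>r \<epsilon>\<close> of \<open>C\<^sup>*\<close>, so the element
  \<open>f(c\<^sub>i) m\<^sub>i\<close> is \<open>m\<^sub>i \<cdot> (f(c\<^sub>i) \<epsilon>)\<close>.
\<close>

definition rational_part ::
    "('k::field \<Rightarrow> 'c::ab_group_add \<Rightarrow> 'c) \<Rightarrow> ('c \<Rightarrow> ('c \<times> 'c \<Rightarrow>\<^sub>0 'k) set) \<Rightarrow> ('c \<Rightarrow> 'k)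
       \<Rightarrow> ('c \<Rightarrow> 'k, 'm, 'q) right_mod_scheme \<Rightarrow> 'm set" where
  "rational_part scale \<Delta> \<epsilon> M = {m \<in> carrier M.
     \<exists>(n::nat) ms cs. (\<forall>i<n. ms i \<in> carrier M) \<and>
       (\<forall>f\<in>carrier (dual_algebra scale \<Delta> \<epsilon>).
          m \<cdot>\<^bsub>M\<^esub> f = (\<Oplus>\<^bsub>M\<^esub>i\<in>{..<n}. ms i \<cdot>\<^bsub>M\<^esub> (\<lambda>c. f (cs i) * \<epsilon> c)))}"

end

theory Submission
  imports Defs "HOL-Library.Function_Algebras"
begin

text \<open>
  Write \<open>h \<rightharpoonup> c = c\<^sub>1 h(c\<^sub>2)\<close> (below \<open>lhit h c\<close>) and \<open>c \<leftharpoonup> f = f(c\<^sub>1) c\<^sub>2\<close> (below \<open>rhit f c\<close>).  A rational element is one that is killed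
  by \<open>E\<^sup>\<bottom>\<close> for some finite dimensional \<open>E \<subseteq> C\<close>, so splitting of cyclic modules makes every
  \<open>Rat(C\<^sup>*/Z\<^sup>\<bottom>)\<close> finite dimensional.  Consequently \<open>C\<close> contains no infinite direct sum of nonzero left
  submodules, i.e. some finite dimensional subcoalgebra \<open>D\<close> meets every nonzero left submodule; all
  wedge powers \<open>D\<^sub>n\<close> of \<open>D\<close> are finite dimensional and they exhaust \<open>C\<close>.  Moreover every \<open>D\<^sub>n\<^sup>\<bottom>\<close> is a
  finitely generated left ideal, because finitely generated left ideals are closed (a functional
  that vanishes where finitely many maps \<open>g \<rightharpoonup> _\<close> vanish factors through them).

  If \<open>C\<close> is infinite dimensional, then for every \<open>n\<close> some product of \<open>x\<^sub>n, y\<^sub>n \<in> D\<^sub>n\<^sup>\<bottom>\<close> does not vanish on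
  some \<open>D\<^sub>m\<close> with \<open>m = m(n)\<close>.  In \<open>M = \<Prod>\<^sub>n C\<^sup>*/D\<^sub>m\<^sub>(\<^sub>n\<^sub>)\<^sup>\<bottom>\<close> the element \<open>x = (x\<^sub>n)\<close> is not rational.  But
  up to finitely many, hence rational, components it lies in \<open>\<Sum> M w\<close>, with \<open>w\<close> ranging over the finitely
  many generators of \<open>D\<^sub>k\<^sup>\<bottom>\<close>.  So does therefore its component in a complement of \<open>Rat(M)\<close>, for every
  \<open>k\<close>, and \<open>\<Inter>\<^sub>k \<Sum> M w = 0\<close>: thus \<open>x\<close> is rational, a contradiction.
\<close>

section \<open>Linear functionals\<close>

locale functionals = vector_space scale
  for scale :: "'a::field \<Rightarrow> 'b::ab_group_add \<Rightarrow> 'b"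
begin

definition dual_space :: "('b \<Rightarrow> 'a) set" where
  "dual_space = {f. Vector_Spaces.linear scale (*) f}"

definition ann :: "'b set \<Rightarrow> ('b \<Rightarrow> 'a) set" where
  "ann S = {f \<in> dual_space. \<forall>s\<in>S. f s = 0}"

definition fin_dim :: "'b set \<Rightarrow> bool" where
  "fin_dim S \<longleftrightarrow> (\<exists>B. finite B \<and> S \<subseteq> span B)"

lemma vector_space_field: "vector_space ((*) :: 'a \<Rightarrow> 'a \<Rightarrow> 'a)"
  by standard (simp_all add: algebra_simps)

lemma dual_iff:
  "f \<in> dual_space \<longleftrightarrow> (\<forall>x y. f (x + y) = f x + f y) \<and> (\<forall>r x. f (scale r x) = r * f x)"
  using vector_space_field vector_space_axioms by (auto simp: dual_space_def Vector_Spaces.linear_iff)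

lemma dualI:
  "(\<And>x y. f (x + y) = f x + f y) \<Longrightarrow> (\<And>r x. f (scale r x) = r * f x) \<Longrightarrow> f \<in> dual_space"
  by (simp add: dual_iff)

lemma dual_add: "f \<in> dual_space \<Longrightarrow> f (x + y) = f x + f y"
  and dual_scale: "f \<in> dual_space \<Longrightarrow> f (scale r x) = r * f x"
  by (auto simp: dual_iff)

lemma dual_0: "f \<in> dual_space \<Longrightarrow> f 0 = 0"
  using dual_scale[of f 0 0] by simp

lemma dual_neg: "f \<in> dual_space \<Longrightarrow> f (- x) = - f x"
  using dual_scale[of f "-1" x] by simp

lemma dual_diff: "f \<in> dual_space \<Longrightarrow> f (x - y) = f x - f y"
  using dual_add[of f x "- y"] by (simp add: dual_neg)

lemma dual_closed:
  shows "f \<in> dual_space \<Longrightarrow> g \<in> dual_space \<Longrightarrow> f + g \<in> dual_space"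
    and "f \<in> dual_space \<Longrightarrow> g \<in> dual_space \<Longrightarrow> f - g \<in> dual_space"
    and "f \<in> dual_space \<Longrightarrow> - f \<in> dual_space"
    and "0 \<in> dual_space"
    and "f \<in> dual_space \<Longrightarrow> (\<lambda>c. r * f c) \<in> dual_space"
  by (auto simp: dual_iff algebra_simps)

lemma dual_sum_closed: "(\<And>i. i \<in> I \<Longrightarrow> f i \<in> dual_space) \<Longrightarrow> (\<Sum>i\<in>I. f i) \<in> dual_space"
  by (induction I rule: infinite_finite_induct) (auto simp: dual_iff algebra_simps)

lemma dual_comp:
  "f \<in> dual_space \<Longrightarrow> Vector_Spaces.linear scale scale T \<Longrightarrow> (\<lambda>c. f (T c)) \<in> dual_space"
  by (auto simp: dual_iff Vector_Spaces.linear_iff)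

lemma ann_dual: "f \<in> ann S \<Longrightarrow> f \<in> dual_space"
  by (simp add: ann_def)

lemma annD: "f \<in> ann S \<Longrightarrow> s \<in> S \<Longrightarrow> f s = 0"
  by (simp add: ann_def)

lemma subspace_ker: "f \<in> dual_space \<Longrightarrow> subspace {x. f x = 0}"
  by (auto simp: subspace_def dual_add dual_scale dual_0)

lemma ann_span: "ann (span S) = ann S"
proof -
  have "f v = 0" if "f \<in> ann S" "v \<in> span S" for f v
    using span_minimal[of S "{x. f x = 0}"] that subspace_ker[of f] by (auto simp: ann_def)
  then show ?thesis
    by (auto simp: ann_def span_base)
qed

lemma ann_mono: "S \<subseteq> S' \<Longrightarrow> ann S' \<subseteq> ann S"
  by (auto simp: ann_def)

lemma extend_functional:
  assumes "independent B"
  obtains f where "f \<in> dual_space" "\<forall>b\<in>B. f b = g b"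
proof -
  interpret p: vector_space_pair scale "(*) :: 'a \<Rightarrow> 'a \<Rightarrow> 'a"
    by (simp add: vector_space_pair_def vector_space_axioms vector_space_field)
  from p.linear_independent_extend[OF assms, of g] show thesis
    using that by (auto simp: dual_space_def)
qed

lemma ann_separates:
  assumes "subspace S" "w \<notin> S"
  obtains f where "f \<in> ann S" "f w = 1"
proof -
  obtain B where B: "B \<subseteq> S" "independent B" "S \<subseteq> span B"
    using maximal_independent_subset by blast
  have sp: "span B = S"
    using B assms(1) span_subspace by blast
  then have "independent (insert w B)"
    using assms(2) B(2) by (intro independent_insertI) auto
  then obtain f where f: "f \<in> dual_space" "\<forall>b\<in>insert w B. f b = (if b = w then 1 else 0)"
    by (rule extend_functional)
  have "w \<notin> B"
    using B(1) assms(2) by auto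
  then have "f \<in> ann B"
    using f by (auto simp: ann_def)
  then have "f \<in> ann S"
    using ann_span[of B] sp by simp
  then show thesis
    using that f by simp
qed

text \<open>Equations between vectors are later verified after applying a functional, where the two
  actions turn into convolution products.\<close>

lemma dual_separates:
  assumes "\<And>f. f \<in> dual_space \<Longrightarrow> f x = f y"
  shows "x = y"
proof (rule ccontr)
  assume "x \<noteq> y"
  then have "x - y \<notin> {0}"
    by simp
  then obtain f where "f \<in> ann {0}" "f (x - y) = 1"
    by (rule ann_separates[OF subspace_single_0])
  then show False
    using assms[of f] by (simp add: dual_diff ann_def)
qed

section \<open>Finite dimensional sets and ascending chains\<close>

lemma fin_dim_mono: "fin_dim T \<Longrightarrow> S \<subseteq> T \<Longrightarrow> fin_dim S"
  unfolding fin_dim_def by (meson order_trans)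

lemma fin_dim_span: "fin_dim S \<Longrightarrow> fin_dim (span S)"
  unfolding fin_dim_def by (metis span_minimal subspace_span)

lemma fin_dim_span_finite: "finite B \<Longrightarrow> fin_dim (span B)"
  unfolding fin_dim_def by blast

lemma fin_dim_Un:
  assumes "fin_dim S" "fin_dim T"
  shows "fin_dim (S \<union> T)"
proof -
  obtain A B where "finite A" "finite B" "S \<subseteq> span A" "T \<subseteq> span B"
    using assms by (auto simp: fin_dim_def)
  then have "finite (A \<union> B)" "S \<union> T \<subseteq> span (A \<union> B)"
    using span_mono[of A "A \<union> B"] span_mono[of B "A \<union> B"] by auto
  then show ?thesis
    unfolding fin_dim_def by blast
qed

lemma fin_dim_UN: "finite I \<Longrightarrow> (\<And>i. i \<in> I \<Longrightarrow> fin_dim (S i)) \<Longrightarrow> fin_dim (\<Union>i\<in>I. S i)"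
proof (induction I rule: finite_induct)
  case empty
  then show ?case
    by (auto simp: fin_dim_def intro: exI[of _ "{}"])
qed (auto intro: fin_dim_Un)

lemma fin_dim_basis:
  assumes "fin_dim S" "subspace S"
  obtains B where "finite B" "independent B" "span B = S"
proof -
  obtain A where A: "finite A" "S \<subseteq> span A"
    using assms by (auto simp: fin_dim_def)
  obtain B where B: "B \<subseteq> S" "independent B" "S \<subseteq> span B"
    using maximal_independent_subset by blast
  have "finite B"
    using independent_span_bound[OF A(1) B(2)] B(1) A(2) by auto
  then show thesis
    using that B assms(2) span_subspace by metis
qed

lemma fin_dim_image:
  assumes "fin_dim S" "Vector_Spaces.linear scale scale T"
  shows "fin_dim (T ` S)"
proof -
  obtain A where A: "finite A" "S \<subseteq> span A"
    using assms by (auto simp: fin_dim_def)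
  have "T ` S \<subseteq> span (T ` A)"
    using A(2) module_hom.span_image[of scale scale T A] assms(2)
    by (auto simp: module_hom_iff_linear)
  then show ?thesis
    using A(1) unfolding fin_dim_def by blast
qed

lemma fin_dim_sums:
  assumes "fin_dim S" "fin_dim T"
  shows "fin_dim {x + y |x y. x \<in> S \<and> y \<in> T}"
proof -
  have "{x + y |x y. x \<in> S \<and> y \<in> T} \<subseteq> span (S \<union> T)"
    by (auto intro!: span_add intro: span_base)
  then show ?thesis
    using fin_dim_mono fin_dim_span fin_dim_Un[OF assms] by blast
qed

lemma fin_dim_subset_chain:
  fixes D :: "nat \<Rightarrow> 'b set"
  assumes "incseq D" "\<And>n. subspace (D n)" "fin_dim S" "subspace S" "S \<subseteq> (\<Union>n. D n)"
  obtains n where "S \<subseteq> D n"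
proof -
  obtain B where B: "finite B" "span B = S"
    by (rule fin_dim_basis[OF assms(3,4)])
  have "\<exists>n. B' \<subseteq> D n" if "finite B'" "B' \<subseteq> S" for B'
    using that
  proof (induction B' rule: finite_induct)
    case (insert b B')
    then obtain n m where "B' \<subseteq> D n" "b \<in> D m"
      using assms(5) by auto
    then have "insert b B' \<subseteq> D (max n m)"
      using incseqD[OF assms(1), of n "max n m"] incseqD[OF assms(1), of m "max n m"] by auto
    then show ?case
      by blast
  qed auto
  then obtain n where "B \<subseteq> D n"
    using B span_superset by metis
  then have "S \<subseteq> D n"
    using B(2) span_minimal assms(2) by blast
  then show thesis
    using that by blast
qed

lemma subspace_UN_chain:
  fixes D :: "nat \<Rightarrow> 'b set"
  assumes "incseq D" "\<And>n. subspace (D n)"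
  shows "subspace (\<Union>n. D n)"
proof (rule subspaceI)
  show "0 \<in> (\<Union>n. D n)"
    using subspace_0[OF assms(2)] by blast
next
  fix x y
  assume "x \<in> (\<Union>n. D n)" "y \<in> (\<Union>n. D n)"
  then obtain n m where "x \<in> D n" "y \<in> D m"
    by auto
  then have "x \<in> D (max n m)" "y \<in> D (max n m)"
    using incseqD[OF assms(1), of n "max n m"] incseqD[OF assms(1), of m "max n m"] by auto
  then show "x + y \<in> (\<Union>n. D n)"
    using subspace_add[OF assms(2)] by blast
next
  fix r x
  assume "x \<in> (\<Union>n. D n)"
  then show "scale r x \<in> (\<Union>n. D n)"
    using subspace_scale[OF assms(2)] by blast
qed

section \<open>Factoring functionals through linear maps\<close>

text \<open>Vanishing on the kernel lets \<open>f\<close> descend to the image of \<open>S\<close>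
  under \<open>T\<close>; a basis of that image is lifted to \<open>S\<close> to define
  \<open>a\<close>, which then extends to the whole space.\<close>

lemma factor_functional:
  assumes f: "f \<in> dual_space" and T: "Vector_Spaces.linear scale scale T" and S: "subspace S"
    and ker: "\<And>z. z \<in> S \<Longrightarrow> T z = 0 \<Longrightarrow> f z = 0"
  obtains a where "a \<in> dual_space" "\<forall>z\<in>S. f z = a (T z)"
proof -
  interpret T: Vector_Spaces.linear scale scale T by fact
  obtain B where B: "B \<subseteq> T ` S" "independent B" "T ` S \<subseteq> span B"
    using maximal_independent_subset by blast
  have "\<forall>b\<in>B. \<exists>z. z \<in> S \<and> T z = b"
    using B(1) by auto
  from bchoice[OF this] obtain z where z: "\<And>b. b \<in> B \<Longrightarrow> z b \<in> S \<and> T (z b) = b"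
    by blast
  obtain a where a: "a \<in> dual_space" "\<forall>b\<in>B. a b = f (z b)"
    by (rule extend_functional[OF B(2)])
  have "f v = a (T v)" if "v \<in> S" for v
  proof -
    have "T v \<in> span B"
      using that B(3) by auto
    then have "\<exists>u\<in>S. T u = T v \<and> f u = a (T v)"
    proof (induction rule: span_induct_alt)
      case base
      show ?case
        using subspace_0[OF S] by (intro bexI[of _ 0]) (simp_all add: T.zero dual_0 f a(1))
    next
      case (step c x y)
      then obtain u where u: "u \<in> S" "T u = y" "f u = a y"
        by blast
      have "scale c (z x) + u \<in> S"
        using z[OF step(1)] u S by (auto intro: subspace_add subspace_scale)
      moreover have "T (scale c (z x) + u) = scale c x + y"
        using z[OF step(1)] u by (simp add: T.add T.scale)
      moreover have "f (scale c (z x) + u) = a (scale c x + y)"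
        using u a step(1) f by (simp add: dual_add dual_scale)
      ultimately show ?case
        by blast
    qed
    then obtain u where "u \<in> S" "T u = T v" "f u = a (T v)"
      by blast
    then have "f (v - u) = 0"
      using that S by (intro ker) (simp_all add: subspace_diff T.diff)
    then show ?thesis
      using \<open>f u = a (T v)\<close> f by (simp add: dual_diff)
  qed
  then show thesis
    by (intro that[OF a(1)] ballI)
qed

text \<open>Induction on \<open>G\<close>: on the common kernel of the other maps \<open>f\<close>
  factors through \<open>T h\<close>, and subtracting that part leaves a functional that vanishes on
  this common kernel. Applied with \<open>T g = lhit g\<close>, it says that a finitely generated
  left ideal of the dual algebra is closed.\<close>

lemma factor_functional_finite:
  assumes "finite G" "f \<in> dual_space" "\<And>g. g \<in> G \<Longrightarrow> Vector_Spaces.linear scale scale (T g)"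
    and "\<And>z. (\<And>g. g \<in> G \<Longrightarrow> T g z = 0) \<Longrightarrow> f z = 0"
  shows "\<exists>a. (\<forall>g\<in>G. a g \<in> dual_space) \<and> (\<forall>z. f z = (\<Sum>g\<in>G. a g (T g z)))"
  using assms
proof (induction G arbitrary: f rule: finite_induct)
  case empty
  then show ?case
    by simp
next
  case (insert h G)
  have "subspace {z. T g z = 0}" if "g \<in> G" for g
    using insert(5) that by (intro module_hom.subspace_kernel) (auto simp: module_hom_iff_linear)
  then have sub: "subspace (\<Inter>g\<in>G. {z. T g z = 0})"
    by (intro subspace_Int)
  have ker: "f z = 0" if "z \<in> (\<Inter>g\<in>G. {z. T g z = 0})" "T h z = 0" for z
    by (rule insert(6)) (use that in blast)
  obtain b
    where b: "b \<in> dual_space" "\<forall>z \<in> (\<Inter>g\<in>G. {z. T g z = 0}). f z = b (T h z)"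
    by (rule factor_functional[OF insert(4) insert(5)[OF insertI1] sub ker])
  define f' where "f' = f - (\<lambda>z. b (T h z))"
  have "f' \<in> dual_space"
    unfolding f'_def by (rule dual_closed(2)[OF insert(4) dual_comp[OF b(1) insert(5)[OF insertI1]]])
  moreover have "f' z = 0" if "\<And>g. g \<in> G \<Longrightarrow> T g z = 0" for z
    using b(2) that by (simp add: f'_def)
  ultimately have "\<exists>a. (\<forall>g\<in>G. a g \<in> dual_space) \<and> (\<forall>z. f' z = (\<Sum>g\<in>G. a g (T g z)))"
    using insert(5) by (intro insert(3)) simp_all
  then obtain a where a: "\<forall>g\<in>G. a g \<in> dual_space"
    "\<forall>z. f z - b (T h z) = (\<Sum>g\<in>G. a g (T g z))"
    by (auto simp: f'_def)
  have "(\<Sum>g\<in>insert h G. (a(h := b)) g (T g z)) = f z" for z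
  proof -
    have "(\<Sum>g\<in>insert h G. (a(h := b)) g (T g z)) = b (T h z) + (\<Sum>g\<in>G. a g (T g z))"
      using insert(1,2) by (auto intro: sum.cong)
    then show ?thesis
      using a(2)[rule_format, of z] by (simp add: algebra_simps)
  qed
  then show ?case
    using a b by (intro exI[of _ "a(h := b)"]) auto
qed

text \<open>Each vector added to a finite spanning set enlarges the space of common zeros of
  \<open>G\<close> by at most one dimension modulo \<open>D\<close>, so one further functional
  suffices.\<close>

lemma finite_ann_separates:
  assumes "fin_dim V" "subspace D"
  obtains G where "finite G" "G \<subseteq> ann D" "\<forall>w\<in>V. (\<forall>g\<in>G. g w = 0) \<longrightarrow> w \<in> D"
proof -
  obtain B where B: "finite B" "V \<subseteq> span B"
    using assms by (auto simp: fin_dim_def)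
  from B(1) have "\<exists>G. finite G \<and> G \<subseteq> ann D \<and> (\<forall>w\<in>span B. (\<forall>g\<in>G. g w = 0) \<longrightarrow> w \<in> D)"
  proof (induction B rule: finite_induct)
    case empty
    then show ?case
      using subspace_0[OF assms(2)] by (intro exI[of _ "{}"]) auto
  next
    case (insert b B)
    then obtain G where G: "finite G" "G \<subseteq> ann D" "\<And>w. w \<in> span B \<Longrightarrow> \<forall>g\<in>G. g w = 0 \<Longrightarrow> w \<in> D"
      by blast
    show ?case
    proof (cases "\<forall>w\<in>span (insert b B). (\<forall>g\<in>G. g w = 0) \<longrightarrow> w \<in> D")
      case True
      then show ?thesis
        using G by blast
    next
      case False
      then obtain s where s: "s \<in> span (insert b B)" "\<forall>g\<in>G. g s = 0" "s \<notin> D"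
        by blast
      obtain h where h: "h \<in> ann D" "h s = 1"
        using ann_separates[OF assms(2) s(3)] by blast
      obtain \<beta> where \<beta>: "s - scale \<beta> b \<in> span B"
        using s(1) by (auto simp: span_breakdown_eq)
      have "\<beta> \<noteq> 0"
        using \<beta> G(3) s by auto
      have "w \<in> D" if w: "w \<in> span (insert b B)" "\<forall>g\<in>insert h G. g w = 0" for w
      proof -
        obtain \<alpha> where \<alpha>: "w - scale \<alpha> b \<in> span B"
          using w(1) by (auto simp: span_breakdown_eq)
        \<comment> \<open>Subtracting a multiple of \<open>s\<close> cancels the
          \<open>b\<close>-component and leaves a common zero of \<open>G\<close>, so
          \<open>v\<close> is in \<open>D\<close>; then \<open>h\<close> forces the multiple to be
          0.\<close>
        define v where "v = w - scale (\<alpha> / \<beta>) s"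
        have "v = (w - scale \<alpha> b) - scale (\<alpha> / \<beta>) (s - scale \<beta> b)"
          using \<open>\<beta> \<noteq> 0\<close> by (simp add: v_def scale_right_diff_distrib)
        then have "v \<in> span B"
          using \<alpha> \<beta> by (simp add: span_diff span_scale)
        moreover have "\<forall>g\<in>G. g v = 0"
          using G(2) w(2) s(2) by (auto simp: v_def dual_diff dual_scale ann_def subset_iff)
        ultimately have "v \<in> D"
          using G(3) by blast
        then have "h v = 0"
          using h by (simp add: ann_def)
        then have "\<alpha> = 0"
          using h w(2) \<open>\<beta> \<noteq> 0\<close> by (simp add: v_def dual_diff dual_scale ann_def)
        then show ?thesis
          using \<open>v \<in> D\<close> by (simp add: v_def)
      qed
      then show ?thesis
        using G h by (intro exI[of _ "insert h G"]) auto
    qed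
  qed
  then obtain G where "finite G" "G \<subseteq> ann D" "\<forall>w\<in>span B. (\<forall>g\<in>G. g w = 0) \<longrightarrow> w \<in> D"
    by blast
  then show thesis
    using that[of G] B(2) by blast
qed

end

section \<open>The two actions of the dual algebra on a coalgebra\<close>

lemma keys_free_scale: "Poly_Mapping.keys (free_scale r x) \<subseteq> Poly_Mapping.keys x"
  by (auto simp: free_scale_def in_keys_iff map.rep_eq when_def)

lemma lookup_free_scale: "Poly_Mapping.lookup (free_scale r x) p = r * Poly_Mapping.lookup x p"
  by (simp add: free_scale_def map.rep_eq when_def)

lemma vector_space_free: "vector_space (free_scale :: 'k::field \<Rightarrow> ('x \<Rightarrow>\<^sub>0 'k) \<Rightarrow> _)"
  by standard
    (rule poly_mapping_eqI, simp add: lookup_free_scale lookup_add algebra_simps)+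

context vector_space
begin

lemma linear_lin_ext: "Vector_Spaces.linear free_scale scale (lin_ext scale \<phi>)"
proof -
  have "lin_ext scale \<phi> (x + y) = lin_ext scale \<phi> x + lin_ext scale \<phi> y" for x y
    unfolding lin_ext_def
    by (rule setsum_keys_plus_distrib[where f = "\<lambda>p r. scale r (\<phi> p)"])
      (simp_all add: scale_left_distrib)
  moreover have "lin_ext scale \<phi> (free_scale r x) = scale r (lin_ext scale \<phi> x)" for r x
  proof -
    have "lin_ext scale \<phi> (free_scale r x)
        = (\<Sum>p\<in>Poly_Mapping.keys x. scale (Poly_Mapping.lookup (free_scale r x) p) (\<phi> p))"
      unfolding lin_ext_def
    proof (rule sum.mono_neutral_left)
      show "Poly_Mapping.keys (free_scale r x) \<subseteq> Poly_Mapping.keys x"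
        by (rule keys_free_scale)
    qed (simp_all add: in_keys_iff)
    then show ?thesis
      by (simp add: lin_ext_def lookup_free_scale scale_sum_right)
  qed
  ultimately show ?thesis
    using vector_space_free vector_space_axioms by (simp add: Vector_Spaces.linear_iff)
qed

lemma lin_ext_basis_vec: "lin_ext scale \<phi> (basis_vec p) = \<phi> p"
  by (simp add: lin_ext_def basis_vec_def)

lemma lin_ext_add_fun:
  "lin_ext scale (\<lambda>p. \<phi> p + \<psi> p) x = lin_ext scale \<phi> x + lin_ext scale \<psi> x"
  by (simp add: lin_ext_def scale_right_distrib sum.distrib)

lemma lin_ext_scale_fun: "lin_ext scale (\<lambda>p. scale r (\<phi> p)) x = scale r (lin_ext scale \<phi> x)"
  by (simp add: lin_ext_def scale_sum_right mult.commute)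

text \<open>The universal property of the tensor power: the linear extension of a multilinear
  \<open>\<phi>\<close> kills every generator of the relations.\<close>

lemma lin_ext_relations:
  assumes "x - y \<in> multilinear_relations s J"
    and add: "\<And>j a b. j \<in> J \<Longrightarrow> \<phi> (j (a + b)) = \<phi> (j a) + \<phi> (j b)"
    and hom: "\<And>j r a. j \<in> J \<Longrightarrow> \<phi> (j (s r a)) = scale r (\<phi> (j a))"
  shows "lin_ext scale \<phi> x = lin_ext scale \<phi> y"
proof -
  interpret l: Vector_Spaces.linear free_scale scale "lin_ext scale \<phi>"
    by (rule linear_lin_ext)
  have "lin_ext scale \<phi> (x - y) = 0"
    using assms(1) unfolding multilinear_relations_def
  proof (rule l.eq_0_on_span[rotated])
    fix v
    assume "v \<in> (\<Union>j\<in>J. {basis_vec (j (a + b)) - basis_vec (j a) - basis_vec (j b) |a b. True} \<union>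
                  {basis_vec (j (s r a)) - free_scale r (basis_vec (j a)) |r a. True})"
    then obtain j where j: "j \<in> J" and
      "(\<exists>a b. v = basis_vec (j (a + b)) - basis_vec (j a) - basis_vec (j b))
        \<or> (\<exists>r a. v = basis_vec (j (s r a)) - free_scale r (basis_vec (j a)))"
      by blast
    then show "lin_ext scale \<phi> v = 0"
      using add[OF j] hom[OF j] by (elim disjE exE) (simp_all add: l.diff l.scale lin_ext_basis_vec)
  qed
  then show ?thesis
    by (simp add: l.diff)
qed

end

lemma linear_apply_lin_ext:
  assumes "Vector_Spaces.linear s1 s2 T"
  shows "T (lin_ext s1 \<phi> x) = lin_ext s2 (\<lambda>p. T (\<phi> p)) x"
proof -
  interpret T: Vector_Spaces.linear s1 s2 T by fact
  show ?thesis
    by (simp add: lin_ext_def T.sum T.scale)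
qed


context coalgebra
begin

sublocale functionals scale ..

section \<open>The two actions and the convolution product\<close>

definition lhit :: "('c \<Rightarrow> 'k) \<Rightarrow> 'c \<Rightarrow> 'c" where
  "lhit h c = lin_ext scale (\<lambda>(a, b). scale (h b) a) (sweedler (\<Delta> c))"

definition rhit :: "('c \<Rightarrow> 'k) \<Rightarrow> 'c \<Rightarrow> 'c" where
  "rhit f c = lin_ext scale (\<lambda>(a, b). scale (f a) b) (sweedler (\<Delta> c))"

abbreviation conv :: "('c \<Rightarrow> 'k) \<Rightarrow> ('c \<Rightarrow> 'k) \<Rightarrow> 'c \<Rightarrow> 'k" where
  "conv \<equiv> convolution \<Delta>"

lemma counit_dual: "\<epsilon> \<in> dual_space"
  using counit_linear by (simp add: dual_space_def)

lemma sweedler_mem: "sweedler (\<Delta> c) \<in> \<Delta> c"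
proof -
  interpret F: vector_space "free_scale :: 'k \<Rightarrow> ('c \<times> 'c \<Rightarrow>\<^sub>0 'k) \<Rightarrow> _"
    by (rule vector_space_free)
  obtain z where "\<Delta> c = tensor_class scale slots2 z"
    using comult_tensor[of c] by (auto simp: tensor_square_def)
  then have "z \<in> \<Delta> c"
    by (simp add: tensor_class_def multilinear_relations_def F.span_zero)
  then show ?thesis
    unfolding sweedler_def by (rule someI)
qed

text \<open>Makes the choice in \<open>sweedler\<close> irrelevant, so that it can be exchanged for
  sums and multiples of representatives when linearity of \<open>\<Delta>\<close> is used.\<close>

lemma lin_ext_comult:
  assumes "x \<in> \<Delta> c" "y \<in> \<Delta> c"
    and "\<And>a b b'. \<phi> (a, b + b') = \<phi> (a, b) + \<phi> (a, b')"
    and "\<And>a a' b. \<phi> (a + a', b) = \<phi> (a, b) + \<phi> (a', b)"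
    and "\<And>r a b. \<phi> (a, scale r b) = scale r (\<phi> (a, b))"
    and "\<And>r a b. \<phi> (scale r a, b) = scale r (\<phi> (a, b))"
  shows "lin_ext scale \<phi> x = lin_ext scale \<phi> y"
proof -
  obtain z where z: "\<Delta> c = tensor_class scale slots2 z"
    using comult_tensor[of c] by (auto simp: tensor_square_def)
  have "lin_ext scale \<phi> v = lin_ext scale \<phi> z" if "v \<in> \<Delta> c" for v
  proof (rule lin_ext_relations[where s = scale and J = slots2])
    show "v - z \<in> multilinear_relations scale slots2"
      using that z by (simp add: tensor_class_def)
  qed (auto simp: slots2_def assms(3-))
  then show ?thesis
    using assms(1,2) by metis
qed

lemma linear_lin_ext_comult:
  assumes "\<And>a b b'. \<phi> (a, b + b') = \<phi> (a, b) + \<phi> (a, b')"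
    and "\<And>a a' b. \<phi> (a + a', b) = \<phi> (a, b) + \<phi> (a', b)"
    and "\<And>r a b. \<phi> (a, scale r b) = scale r (\<phi> (a, b))"
    and "\<And>r a b. \<phi> (scale r a, b) = scale r (\<phi> (a, b))"
  shows "Vector_Spaces.linear scale scale (\<lambda>c. lin_ext scale \<phi> (sweedler (\<Delta> c)))"
proof -
  interpret l: Vector_Spaces.linear free_scale scale "lin_ext scale \<phi>"
    by (rule linear_lin_ext)
  have rep: "lin_ext scale \<phi> (sweedler (\<Delta> c)) = lin_ext scale \<phi> x" if "x \<in> \<Delta> c" for x c
    by (rule lin_ext_comult[OF sweedler_mem that]) (rule assms)+
  have "lin_ext scale \<phi> (sweedler (\<Delta> (a + b)))
      = lin_ext scale \<phi> (sweedler (\<Delta> a)) + lin_ext scale \<phi> (sweedler (\<Delta> b))" for a b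
    using rep[OF comult_add[OF sweedler_mem sweedler_mem]] by (simp add: l.add)
  moreover have "lin_ext scale \<phi> (sweedler (\<Delta> (scale r a)))
      = scale r (lin_ext scale \<phi> (sweedler (\<Delta> a)))" for r a
    using rep[OF comult_scale[OF sweedler_mem]] by (simp add: l.scale)
  ultimately show ?thesis
    using vector_space_axioms by (simp add: Vector_Spaces.linear_iff)
qed

lemma linear_lhit: "h \<in> dual_space \<Longrightarrow> Vector_Spaces.linear scale scale (lhit h)"
  unfolding lhit_def[abs_def]
  by (rule linear_lin_ext_comult)
    (auto simp: dual_add dual_scale scale_left_distrib scale_right_distrib mult.commute)

lemma linear_rhit: "f \<in> dual_space \<Longrightarrow> Vector_Spaces.linear scale scale (rhit f)"
  unfolding rhit_def[abs_def]
  by (rule linear_lin_ext_comult)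
    (auto simp: dual_add dual_scale scale_left_distrib scale_right_distrib mult.commute)

lemma lhit_add: "h \<in> dual_space \<Longrightarrow> lhit h (x + y) = lhit h x + lhit h y"
  and lhit_scale: "h \<in> dual_space \<Longrightarrow> lhit h (scale r x) = scale r (lhit h x)"
  using linear_lhit[of h] by (auto simp: Vector_Spaces.linear_iff)

lemma rhit_add: "h \<in> dual_space \<Longrightarrow> rhit h (x + y) = rhit h x + rhit h y"
  and rhit_scale: "h \<in> dual_space \<Longrightarrow> rhit h (scale r x) = scale r (rhit h x)"
  using linear_rhit[of h] by (auto simp: Vector_Spaces.linear_iff)

lemma lhit_0: "h \<in> dual_space \<Longrightarrow> lhit h 0 = 0"
  using lhit_scale[of h 0 0] by simp

lemma rhit_0: "h \<in> dual_space \<Longrightarrow> rhit h 0 = 0"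
  using rhit_scale[of h 0 0] by simp

lemma lhit_add_left: "lhit (g + h) c = lhit g c + lhit h c"
proof -
  have "(\<lambda>(a, b). scale ((g + h) b) a) = (\<lambda>p. (case p of (a, b) \<Rightarrow> scale (g b) a)
      + (case p of (a, b) \<Rightarrow> scale (h b) a))"
    by (auto simp: scale_left_distrib)
  then show ?thesis
    by (simp add: lhit_def lin_ext_add_fun)
qed

lemma lhit_sum_left: "lhit (\<Sum>i\<in>I. g i) c = (\<Sum>i\<in>I. lhit (g i) c)"
proof (induction I rule: infinite_finite_induct)
  case (insert i I)
  then show ?case
    by (simp only: sum.insert[OF insert(1,2)] lhit_add_left)
qed (auto simp: lhit_def lin_ext_def intro: sum.neutral)

lemma conv_eq_lhit:
  assumes "f \<in> dual_space"
  shows "conv f h c = f (lhit h c)"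
proof -
  have "f (lhit h c) = lin_ext (*) (\<lambda>p. f (case p of (a, b) \<Rightarrow> scale (h b) a)) (sweedler (\<Delta> c))"
    unfolding lhit_def using assms by (intro linear_apply_lin_ext) (simp add: dual_space_def)
  also have "(\<lambda>p. f (case p of (a, b) \<Rightarrow> scale (h b) a)) = (\<lambda>(a, b). f a * h b)"
    using assms by (auto simp: dual_scale mult.commute)
  finally show ?thesis
    by (simp add: convolution_def)
qed

lemma conv_eq_rhit:
  assumes "h \<in> dual_space"
  shows "conv f h c = h (rhit f c)"
proof -
  have "h (rhit f c) = lin_ext (*) (\<lambda>p. h (case p of (a, b) \<Rightarrow> scale (f a) b)) (sweedler (\<Delta> c))"
    unfolding rhit_def using assms by (intro linear_apply_lin_ext) (simp add: dual_space_def)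
  also have "(\<lambda>p. h (case p of (a, b) \<Rightarrow> scale (f a) b)) = (\<lambda>(a, b). f a * h b)"
    using assms by (auto simp: dual_scale)
  finally show ?thesis
    by (simp add: convolution_def)
qed

text \<open>Both sides are \<open>conv f h c\<close>. Hence \<open>lhit h\<close> is the transpose
  of right multiplication by \<open>h\<close>, and \<open>rhit f\<close> that of left multiplication
  by \<open>f\<close>.\<close>

lemma pairing: "f \<in> dual_space \<Longrightarrow> h \<in> dual_space \<Longrightarrow> f (lhit h c) = h (rhit f c)"
  using conv_eq_lhit conv_eq_rhit by metis

lemma conv_dual: "f \<in> dual_space \<Longrightarrow> g \<in> dual_space \<Longrightarrow> conv f g \<in> dual_space"
  by (rule dualI) (simp_all add: conv_eq_lhit lhit_add lhit_scale dual_add dual_scale)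

lemma lhit_counit: "lhit \<epsilon> c = c"
  using counit_right[of c] by (simp add: lhit_def)

lemma rhit_counit: "rhit \<epsilon> c = c"
  using counit_left[of c] by (simp add: rhit_def)

text \<open>Both sides contract the outer factors of the twofold coproduct with \<open>f\<close> and
  \<open>h\<close> and keep the middle one (\<open>?\<tau>\<close>); coassociativity says that the
  two ways of forming it agree.\<close>

lemma lhit_rhit_commute:
  assumes f: "f \<in> dual_space" and h: "h \<in> dual_space"
  shows "lhit h (rhit f c) = rhit f (lhit h c)"
proof -
  let ?\<tau> = "\<lambda>(a, b, c). scale (f a * h c) b"
  let ?x = "sweedler (\<Delta> c)"
  let ?l = "lin_ext free_scale
      (\<lambda>(a, b). lin_ext free_scale (\<lambda>(u, v). basis_vec (u, v, b)) (sweedler (\<Delta> a))) ?x"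
  let ?r = "lin_ext free_scale
      (\<lambda>(a, b). lin_ext free_scale (\<lambda>(u, v). basis_vec (a, u, v)) (sweedler (\<Delta> b))) ?x"
  interpret F: vector_space "free_scale :: 'k \<Rightarrow> ('c \<times> 'c \<times> 'c \<Rightarrow>\<^sub>0 'k) \<Rightarrow> _"
    by (rule vector_space_free)
  have lin: "Vector_Spaces.linear free_scale scale (lin_ext scale ?\<tau>)"
    by (rule linear_lin_ext)
  have "?l \<in> tensor_class scale slots3 ?l"
    by (simp add: tensor_class_def multilinear_relations_def F.span_zero)
  then have "?l \<in> tensor_class scale slots3 ?r"
    using coassoc by simp
  then have "?l - ?r \<in> multilinear_relations scale slots3"
    by (simp add: tensor_class_def)
  then have "lin_ext scale ?\<tau> ?l = lin_ext scale ?\<tau> ?r"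
    by (rule lin_ext_relations)
      (auto simp: slots3_def f h dual_add dual_scale algebra_simps scale_left_distrib scale_right_distrib)
  moreover have "lin_ext scale ?\<tau> ?l = rhit f (lhit h c)"
  proof -
    have "lin_ext scale ?\<tau> (lin_ext free_scale (\<lambda>(u, v). basis_vec (u, v, b)) (sweedler (\<Delta> a)))
        = scale (h b) (rhit f a)" for a b
    proof -
      have "(\<lambda>p. lin_ext scale ?\<tau> (case p of (u, v) \<Rightarrow> basis_vec (u, v, b)))
          = (\<lambda>p. scale (h b) (case p of (u, v) \<Rightarrow> scale (f u) v))"
        by (auto simp: lin_ext_basis_vec mult.commute)
      then show ?thesis
        by (simp add: linear_apply_lin_ext[OF lin] lin_ext_scale_fun rhit_def)
    qed
    then have "(\<lambda>p. lin_ext scale ?\<tau> (case p of (a, b) \<Rightarrow>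
          lin_ext free_scale (\<lambda>(u, v). basis_vec (u, v, b)) (sweedler (\<Delta> a))))
        = (\<lambda>(a, b). scale (h b) (rhit f a))"
      by (simp add: fun_eq_iff split: prod.split)
    then have "lin_ext scale ?\<tau> ?l = lin_ext scale (\<lambda>(a, b). scale (h b) (rhit f a)) ?x"
      by (simp only: linear_apply_lin_ext[OF lin])
    also have "\<dots> = lin_ext scale (\<lambda>p. rhit f (case p of (a, b) \<Rightarrow> scale (h b) a)) ?x"
      by (simp add: rhit_scale[OF f] case_prod_unfold)
    also have "\<dots> = rhit f (lhit h c)"
      by (simp add: lhit_def linear_apply_lin_ext[OF linear_rhit[OF f]])
    finally show ?thesis .
  qed
  moreover have "lin_ext scale ?\<tau> ?r = lhit h (rhit f c)"
  proof -
    have "lin_ext scale ?\<tau> (lin_ext free_scale (\<lambda>(u, v). basis_vec (a, u, v)) (sweedler (\<Delta> b)))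
        = scale (f a) (lhit h b)" for a b
    proof -
      have "(\<lambda>p. lin_ext scale ?\<tau> (case p of (u, v) \<Rightarrow> basis_vec (a, u, v)))
          = (\<lambda>p. scale (f a) (case p of (u, v) \<Rightarrow> scale (h v) u))"
        by (auto simp: lin_ext_basis_vec)
      then show ?thesis
        by (simp add: linear_apply_lin_ext[OF lin] lin_ext_scale_fun lhit_def)
    qed
    then have "(\<lambda>p. lin_ext scale ?\<tau> (case p of (a, b) \<Rightarrow>
          lin_ext free_scale (\<lambda>(u, v). basis_vec (a, u, v)) (sweedler (\<Delta> b))))
        = (\<lambda>(a, b). scale (f a) (lhit h b))"
      by (simp add: fun_eq_iff split: prod.split)
    then have "lin_ext scale ?\<tau> ?r = lin_ext scale (\<lambda>(a, b). scale (f a) (lhit h b)) ?x"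
      by (simp only: linear_apply_lin_ext[OF lin])
    also have "\<dots> = lin_ext scale (\<lambda>p. lhit h (case p of (a, b) \<Rightarrow> scale (f a) b)) ?x"
      by (simp add: lhit_scale[OF h] case_prod_unfold)
    also have "\<dots> = lhit h (rhit f c)"
      by (simp add: rhit_def linear_apply_lin_ext[OF linear_lhit[OF h]])
    finally show ?thesis .
  qed
  ultimately show ?thesis
    by simp
qed

text \<open>Tested against a functional \<open>f\<close>, this is commutation of the two actions
  applied to \<open>lhit h (rhit f c)\<close>.\<close>

lemma lhit_conv:
  assumes "g \<in> dual_space" "h \<in> dual_space"
  shows "lhit (conv g h) c = lhit g (lhit h c)"
proof (rule dual_separates)
  fix f
  assume f: "f \<in> dual_space"
  have "f (lhit (conv g h) c) = conv g h (rhit f c)"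
    using f assms by (simp add: pairing conv_dual)
  also have "\<dots> = g (rhit f (lhit h c))"
    using f assms by (simp add: conv_eq_lhit lhit_rhit_commute)
  finally show "f (lhit (conv g h) c) = f (lhit g (lhit h c))"
    using f assms by (simp add: pairing)
qed

lemma rhit_conv:
  assumes "f \<in> dual_space" "g \<in> dual_space"
  shows "rhit (conv f g) c = rhit g (rhit f c)"
proof (rule dual_separates)
  fix h
  assume h: "h \<in> dual_space"
  have "h (rhit (conv f g) c) = conv f g (lhit h c)"
    using h assms by (simp add: pairing[symmetric] conv_dual)
  also have "\<dots> = g (lhit h (rhit f c))"
    using h assms by (simp add: conv_eq_rhit lhit_rhit_commute)
  finally show "h (rhit (conv f g) c) = h (rhit g (rhit f c))"
    using h assms by (simp add: pairing)
qed

lemma conv_assoc: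
  assumes "f \<in> dual_space" "g \<in> dual_space" "h \<in> dual_space"
  shows "conv (conv f g) h = conv f (conv g h)"
  using assms by (auto simp: conv_eq_lhit conv_dual lhit_conv fun_eq_iff)

lemma conv_counit_left: "f \<in> dual_space \<Longrightarrow> conv \<epsilon> f = f"
  by (auto simp: conv_eq_rhit rhit_counit fun_eq_iff)

lemma conv_counit_right: "f \<in> dual_space \<Longrightarrow> conv f \<epsilon> = f"
  by (auto simp: conv_eq_lhit lhit_counit fun_eq_iff)

lemma conv_add_left:
  "f \<in> dual_space \<Longrightarrow> g \<in> dual_space \<Longrightarrow> conv (f + g) h = conv f h + conv g h"
  by (auto simp: conv_eq_lhit dual_closed fun_eq_iff)

lemma conv_add_right:
  "g \<in> dual_space \<Longrightarrow> h \<in> dual_space \<Longrightarrow> conv f (g + h) = conv f g + conv f h"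
  by (auto simp: conv_eq_rhit dual_closed fun_eq_iff)

lemma conv_scaled_counit: "f \<in> dual_space \<Longrightarrow> conv f (\<lambda>c. r * \<epsilon> c) = (\<lambda>c. r * f c)"
  by (auto simp: conv_eq_rhit dual_closed(5)[OF counit_dual] pairing[symmetric]
      counit_dual lhit_counit fun_eq_iff)

text \<open>Right coideals, \<open>\<Delta> S \<subseteq> S \<otimes> C\<close>, written as
  submodules for the action \<open>lhit\<close>; \<open>rsub\<close> below gives the left coideals,
  and both together the subcoalgebras.\<close>

definition lsub :: "'c set \<Rightarrow> bool" where
  "lsub S \<longleftrightarrow> subspace S \<and> (\<forall>h\<in>dual_space. \<forall>c\<in>S. lhit h c \<in> S)"

definition rsub :: "'c set \<Rightarrow> bool" where
  "rsub S \<longleftrightarrow> subspace S \<and> (\<forall>f\<in>dual_space. \<forall>c\<in>S. rhit f c \<in> S)"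

text \<open>Local finiteness of \<open>C\<close>: everything lies in the span of the finitely many
  first tensor factors of one representative of \<open>\<Delta> c\<close>.\<close>

lemma fin_dim_lorbit: "fin_dim {lhit h c |h. h \<in> dual_space}"
proof -
  have "lhit h c \<in> span (fst ` Poly_Mapping.keys (sweedler (\<Delta> c)))" for h
    unfolding lhit_def lin_ext_def by (intro span_sum span_scale) (force intro: span_scale span_base)
  then show ?thesis
    unfolding fin_dim_def by (intro exI[of _ "fst ` Poly_Mapping.keys (sweedler (\<Delta> c))"]) auto
qed

lemma fin_dim_rorbit: "fin_dim {rhit h c |h. h \<in> dual_space}"
proof -
  have "rhit h c \<in> span (snd ` Poly_Mapping.keys (sweedler (\<Delta> c)))" for h
    unfolding rhit_def lin_ext_def by (intro span_sum span_scale) (force intro: span_scale span_base)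
  then show ?thesis
    unfolding fin_dim_def by (intro exI[of _ "snd ` Poly_Mapping.keys (sweedler (\<Delta> c))"]) auto
qed

end

section \<open>Rational parts of quotients of a power of the dual algebra\<close>

lemma sum_fun_apply: "(\<Sum>i\<in>I. f i) x = (\<Sum>i\<in>I. f i x)"
  by (induction I rule: infinite_finite_induct) simp_all

context coalgebra
begin

abbreviation dual_ring :: "('c \<Rightarrow> 'k) ring" where
  "dual_ring \<equiv> dual_algebra scale \<Delta> \<epsilon>"

lemma dual_ring_simps:
  "carrier dual_ring = dual_space"
  "f \<otimes>\<^bsub>dual_ring\<^esub> g = conv f g"
  "\<one>\<^bsub>dual_ring\<^esub> = \<epsilon>"
  "\<zero>\<^bsub>dual_ring\<^esub> = 0"
  "f \<oplus>\<^bsub>dual_ring\<^esub> g = f + g"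
  by (simp_all add: dual_algebra_def dual_space_def fun_eq_iff)

lemma ring_dual_ring: "ring dual_ring"
proof (rule ringI)
  show "abelian_group dual_ring"
  proof (rule abelian_groupI)
    fix f
    assume "f \<in> carrier dual_ring"
    then show "\<exists>g\<in>carrier dual_ring. g \<oplus>\<^bsub>dual_ring\<^esub> f = \<zero>\<^bsub>dual_ring\<^esub>"
      by (intro bexI[of _ "- f"]) (simp_all add: dual_ring_simps dual_closed)
  qed (simp_all add: dual_ring_simps dual_closed ac_simps)
  show "monoid dual_ring"
    by (rule monoidI)
      (simp_all add: dual_ring_simps conv_dual conv_assoc counit_dual conv_counit_left conv_counit_right)
qed (simp_all add: dual_ring_simps conv_add_left conv_add_right)

section \<open>Families of functionals and rational elements modulo a submodule\<close>

definition families :: "('x \<Rightarrow> 'c \<Rightarrow> 'k) set" where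
  "families = {F. \<forall>i. F i \<in> dual_space}"

definition act :: "('x \<Rightarrow> 'c \<Rightarrow> 'k) \<Rightarrow> ('c \<Rightarrow> 'k) \<Rightarrow> 'x \<Rightarrow> 'c \<Rightarrow> 'k" where
  "act F a = (\<lambda>i. conv (F i) a)"

definition subfam :: "('x \<Rightarrow> 'c \<Rightarrow> 'k) set \<Rightarrow> bool" where
  "subfam N \<longleftrightarrow> N \<subseteq> families \<and> 0 \<in> N \<and> (\<forall>F\<in>N. \<forall>G\<in>N. F + G \<in> N) \<and>
     (\<forall>F\<in>N. \<forall>a\<in>dual_space. act F a \<in> N)"

text \<open>The preimage in \<open>families\<close> of the rational part of the quotient by
  \<open>N\<close>; that this form of rationality agrees with the original one is
  \<open>coset_rational_iff\<close>.\<close>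

definition rat :: "('x \<Rightarrow> 'c \<Rightarrow> 'k) set \<Rightarrow> ('x \<Rightarrow> 'c \<Rightarrow> 'k) set" where
  "rat N = {F \<in> families. \<exists>B. finite B \<and> (\<forall>h\<in>ann B. act F h \<in> N)}"

lemma familiesD: "F \<in> families \<Longrightarrow> F i \<in> dual_space"
  by (simp add: families_def)

lemma subfam_families: "subfam families"
  by (auto simp: subfam_def families_def act_def conv_dual dual_closed)

lemma act_add_left:
  "F \<in> families \<Longrightarrow> G \<in> families \<Longrightarrow> act (F + G) a = act F a + act G a"
  by (auto simp: act_def families_def conv_add_left fun_eq_iff)

lemma act_add_right:
  "a \<in> dual_space \<Longrightarrow> b \<in> dual_space \<Longrightarrow> act F (a + b) = act F a + act F b"
  by (auto simp: act_def conv_add_right fun_eq_iff)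

lemma act_conv:
  "F \<in> families \<Longrightarrow> a \<in> dual_space \<Longrightarrow> b \<in> dual_space \<Longrightarrow> act F (conv a b) = act (act F a) b"
  by (auto simp: act_def families_def conv_assoc fun_eq_iff)

lemma act_counit: "F \<in> families \<Longrightarrow> act F \<epsilon> = F"
  by (auto simp: act_def families_def conv_counit_right fun_eq_iff)

lemma act_uminus_counit: "F \<in> families \<Longrightarrow> act F (- \<epsilon>) = - F"
  by (auto simp: act_def families_def conv_eq_rhit dual_closed(3)[OF counit_dual]
      pairing[symmetric] counit_dual lhit_counit fun_eq_iff)

lemma act_minus_left:
  "F \<in> families \<Longrightarrow> G \<in> families \<Longrightarrow> act (F - G) a = act F a - act G a"
  by (auto simp: act_def families_def conv_eq_lhit dual_closed fun_eq_iff)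

lemma act_zero: "act F 0 = 0"
  by (auto simp: act_def convolution_def lin_ext_def fun_eq_iff intro!: sum.neutral)

lemma subfamD:
  assumes "subfam N"
  shows "F \<in> N \<Longrightarrow> F \<in> families" "0 \<in> N" "F \<in> N \<Longrightarrow> G \<in> N \<Longrightarrow> F + G \<in> N"
    "F \<in> N \<Longrightarrow> a \<in> dual_space \<Longrightarrow> act F a \<in> N"
  using assms by (auto simp: subfam_def)

lemmas families_closed = subfamD(2-4)[OF subfam_families]

text \<open>Negation is the action of \<open>- \<epsilon>\<close>, so it comes with closure under
  \<open>act\<close>.\<close>

lemma subfam_uminus: "subfam N \<Longrightarrow> F \<in> N \<Longrightarrow> - F \<in> N"
  using subfamD(4)[of N F "- \<epsilon>"] subfamD(1)[of N F]
  by (simp add: act_uminus_counit dual_closed(3)[OF counit_dual])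

lemma subfam_minus: "subfam N \<Longrightarrow> F \<in> N \<Longrightarrow> G \<in> N \<Longrightarrow> F - G \<in> N"
  using subfamD(3)[of N F "- G"] subfam_uminus[of N G] by simp

lemma subfam_sum: "subfam N \<Longrightarrow> (\<And>i. i \<in> I \<Longrightarrow> F i \<in> N) \<Longrightarrow> (\<Sum>i\<in>I. F i) \<in> N"
  by (induction I rule: infinite_finite_induct) (simp_all add: subfamD)

lemma subfam_rat:
  assumes N: "subfam N"
  shows "subfam (rat N)" "N \<subseteq> rat N"
proof -
  show "N \<subseteq> rat N"
    using subfamD[OF N] by (auto simp: rat_def ann_def)
  have "F + G \<in> rat N" if FG: "F \<in> rat N" "G \<in> rat N" for F G
  proof -
    obtain B B' where B: "finite B" "\<forall>h\<in>ann B. act F h \<in> N" "finite B'" "\<forall>h\<in>ann B'. act G h \<in> N"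
      and fam: "F \<in> families" "G \<in> families"
      using FG by (auto simp: rat_def)
    have "act (F + G) h \<in> N" if "h \<in> ann (B \<union> B')" for h
      using that B fam subfamD(3)[OF N] by (auto simp: act_add_left ann_def)
    then show ?thesis
      using B fam subfamD(3)[OF subfam_families]
      unfolding rat_def by (intro CollectI conjI exI[of _ "B \<union> B'"]) auto
  qed
  moreover have "act F a \<in> rat N" if F: "F \<in> rat N" and a: "a \<in> dual_space" for F a
  proof -
    obtain B where B: "finite B" "\<forall>h\<in>ann B. act F h \<in> N" and fam: "F \<in> families"
      using F by (auto simp: rat_def)
    \<comment> \<open>\<open>conv a h\<close> vanishes on \<open>B\<close> once \<open>h\<close>
      vanishes on the translate of \<open>B\<close> under \<open>rhit a\<close>, which is again
      finite.\<close>
    have "act (act F a) h \<in> N" if h: "h \<in> ann (rhit a ` B)" for h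
    proof -
      have "conv a h \<in> ann B"
        using h a by (auto simp: ann_def conv_dual conv_eq_rhit)
      then show ?thesis
        using B(2) act_conv[OF fam a ann_dual[OF h]] by auto
    qed
    then show ?thesis
      using B(1) fam a subfamD(4)[OF subfam_families]
      unfolding rat_def by (intro CollectI conjI exI[of _ "rhit a ` B"]) auto
  qed
  ultimately show "subfam (rat N)"
    using \<open>N \<subseteq> rat N\<close> subfamD(2)[OF N] unfolding subfam_def by (auto simp: rat_def)
qed

section \<open>The quotient module on cosets\<close>

definition coset :: "('x \<Rightarrow> 'c \<Rightarrow> 'k) set \<Rightarrow> ('x \<Rightarrow> 'c \<Rightarrow> 'k) \<Rightarrow> ('x \<Rightarrow> 'c \<Rightarrow> 'k) set" where
  "coset N F = {G \<in> families. G - F \<in> N}"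

text \<open>Operations are unions over representatives; for a submodule \<open>N\<close> all
  representatives give the same coset, so the union is that coset.\<close>

definition quotient ::
    "('x \<Rightarrow> 'c \<Rightarrow> 'k) set \<Rightarrow> ('c \<Rightarrow> 'k, ('x \<Rightarrow> 'c \<Rightarrow> 'k) set) right_mod" where
  "quotient N =
     \<lparr>carrier = coset N ` families,
      monoid.mult = undefined,
      one = undefined,
      zero = coset N 0,
      add = (\<lambda>U V. \<Union>F\<in>U. \<Union>G\<in>V. coset N (F + G)),
      ract = (\<lambda>U a. \<Union>F\<in>U. coset N (act F a))\<rparr>"

context
  fixes N :: "('x \<Rightarrow> 'c \<Rightarrow> 'k) set"
  assumes N: "subfam N"
begin

lemma coset_self: "F \<in> families \<Longrightarrow> F \<in> coset N F"
  using subfamD(2)[OF N] by (simp add: coset_def)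

lemma coset_eqI:
  assumes "F - G \<in> N"
  shows "coset N F = coset N G"
proof -
  have "H - G \<in> N \<longleftrightarrow> H - F \<in> N" for H
    using subfamD(3)[OF N _ assms, of "H - F"] subfam_minus[OF N _ assms, of "H - G"] by auto
  then show ?thesis
    by (simp add: coset_def)
qed

lemma coset_eq_iff:
  assumes "F \<in> families"
  shows "coset N F = coset N G \<longleftrightarrow> F - G \<in> N"
proof
  assume "coset N F = coset N G"
  then have "F \<in> coset N G"
    using coset_self[OF assms] by simp
  then show "F - G \<in> N"
    by (simp add: coset_def)
qed (rule coset_eqI)

lemma add_coset:
  assumes "F \<in> families" "G \<in> families"
  shows "coset N F \<oplus>\<^bsub>quotient N\<^esub> coset N G = coset N (F + G)"
proof -
  have "coset N (F' + G') = coset N (F + G)" if "F' \<in> coset N F" "G' \<in> coset N G" for F' G'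
  proof (rule coset_eqI)
    have "(F' - F) + (G' - G) \<in> N"
      using that subfamD(3)[OF N] by (simp add: coset_def)
    then show "F' + G' - (F + G) \<in> N"
      by (simp add: algebra_simps)
  qed
  then have "(\<Union>F'\<in>coset N F. \<Union>G'\<in>coset N G. coset N (F' + G'))
      = (\<Union>F'\<in>coset N F. \<Union>G'\<in>coset N G. coset N (F + G))"
    by (intro SUP_cong refl)
  also have "\<dots> = coset N (F + G)"
    using coset_self[OF assms(1)] coset_self[OF assms(2)] by blast
  finally show ?thesis
    by (simp only: quotient_def ring.simps)
qed

lemma ract_coset:
  assumes "F \<in> families" "a \<in> dual_space"
  shows "coset N F \<cdot>\<^bsub>quotient N\<^esub> a = coset N (act F a)"
proof -
  have "coset N (act F' a) = coset N (act F a)" if "F' \<in> coset N F" for F'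
  proof (rule coset_eqI)
    have "act (F' - F) a \<in> N"
      using that assms subfamD(4)[OF N] by (simp add: coset_def)
    then show "act F' a - act F a \<in> N"
      using that assms by (simp add: act_minus_left coset_def)
  qed
  then have "(\<Union>F'\<in>coset N F. coset N (act F' a)) = (\<Union>F'\<in>coset N F. coset N (act F a))"
    by (intro SUP_cong refl)
  also have "\<dots> = coset N (act F a)"
    using coset_self[OF assms(1)] by blast
  finally show ?thesis
    by (simp only: quotient_def right_mod.simps)
qed

lemma carrier_quotient: "carrier (quotient N) = coset N ` families"
  by (simp add: quotient_def)

lemma zero_quotient: "\<zero>\<^bsub>quotient N\<^esub> = coset N 0"
  by (simp add: quotient_def)

lemma abelian_group_quotient: "abelian_group (quotient N)"
proof (rule abelian_groupI)
  fix U
  assume "U \<in> carrier (quotient N)"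
  then obtain F where F: "F \<in> families" "U = coset N F"
    by (auto simp: carrier_quotient)
  have "- F \<in> families"
    using subfam_uminus[OF subfam_families F(1)] .
  then show "\<exists>V\<in>carrier (quotient N). V \<oplus>\<^bsub>quotient N\<^esub> U = \<zero>\<^bsub>quotient N\<^esub>"
    using F by (intro bexI[of _ "coset N (- F)"]) (simp_all add: carrier_quotient zero_quotient add_coset)
  show "\<zero>\<^bsub>quotient N\<^esub> \<oplus>\<^bsub>quotient N\<^esub> U = U"
    using F by (simp add: zero_quotient add_coset families_closed)
  fix V
  assume "V \<in> carrier (quotient N)"
  then obtain G where G: "G \<in> families" "V = coset N G"
    by (auto simp: carrier_quotient)
  show "U \<oplus>\<^bsub>quotient N\<^esub> V \<in> carrier (quotient N)"
    using F G by (simp add: carrier_quotient add_coset families_closed)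
  show "U \<oplus>\<^bsub>quotient N\<^esub> V = V \<oplus>\<^bsub>quotient N\<^esub> U"
    using F G by (simp add: add_coset add.commute)
  fix W
  assume "W \<in> carrier (quotient N)"
  then obtain H where H: "H \<in> families" "W = coset N H"
    by (auto simp: carrier_quotient)
  show "(U \<oplus>\<^bsub>quotient N\<^esub> V) \<oplus>\<^bsub>quotient N\<^esub> W
      = U \<oplus>\<^bsub>quotient N\<^esub> (V \<oplus>\<^bsub>quotient N\<^esub> W)"
    using F G H by (simp add: add_coset families_closed add.assoc)
next
  show "\<zero>\<^bsub>quotient N\<^esub> \<in> carrier (quotient N)"
    by (simp add: zero_quotient carrier_quotient families_closed)
qed

lemma right_module_quotient: "right_module dual_ring (quotient N)"
proof (intro right_module.intro right_module_axioms.intro)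
  show "ring dual_ring"
    by (rule ring_dual_ring)
  show "abelian_group (quotient N)"
    by (rule abelian_group_quotient)
next
  fix U
  assume "U \<in> carrier (quotient N)"
  then obtain F where F: "F \<in> families" "U = coset N F"
    by (auto simp: carrier_quotient)
  show "U \<cdot>\<^bsub>quotient N\<^esub> \<one>\<^bsub>dual_ring\<^esub> = U"
    using F by (simp add: dual_ring_simps ract_coset counit_dual act_counit)
  fix f
  assume f: "f \<in> carrier dual_ring"
  have f': "f \<in> dual_space"
    using f by (simp add: dual_ring_simps)
  show "U \<cdot>\<^bsub>quotient N\<^esub> f \<in> carrier (quotient N)"
    using F f' by (simp add: carrier_quotient ract_coset families_closed)
  fix g
  assume g: "g \<in> carrier dual_ring"
  then have g': "g \<in> dual_space"
    by (simp add: dual_ring_simps)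
  show "U \<cdot>\<^bsub>quotient N\<^esub> (f \<oplus>\<^bsub>dual_ring\<^esub> g)
      = U \<cdot>\<^bsub>quotient N\<^esub> f \<oplus>\<^bsub>quotient N\<^esub> U \<cdot>\<^bsub>quotient N\<^esub> g"
    using F f' g'
    by (simp add: dual_ring_simps ract_coset add_coset families_closed act_add_right dual_closed(1))
  show "U \<cdot>\<^bsub>quotient N\<^esub> (f \<otimes>\<^bsub>dual_ring\<^esub> g)
      = (U \<cdot>\<^bsub>quotient N\<^esub> f) \<cdot>\<^bsub>quotient N\<^esub> g"
    using F f' g' by (simp add: dual_ring_simps ract_coset families_closed act_conv conv_dual)
next
  fix U V f
  assume "U \<in> carrier (quotient N)" "V \<in> carrier (quotient N)" and f: "f \<in> carrier dual_ring"
  then obtain F G where "F \<in> families" "U = coset N F" "G \<in> families" "V = coset N G"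
    by (auto simp: carrier_quotient)
  then show "(U \<oplus>\<^bsub>quotient N\<^esub> V) \<cdot>\<^bsub>quotient N\<^esub> f
      = U \<cdot>\<^bsub>quotient N\<^esub> f \<oplus>\<^bsub>quotient N\<^esub> V \<cdot>\<^bsub>quotient N\<^esub> f"
    using f by (simp add: dual_ring_simps ract_coset add_coset families_closed act_add_left)
qed

lemma finsum_coset:
  assumes "finite I" "\<And>i. i \<in> I \<Longrightarrow> F i \<in> families"
  shows "(\<Oplus>\<^bsub>quotient N\<^esub>i\<in>I. coset N (F i)) = coset N (\<Sum>i\<in>I. F i)"
proof -
  interpret Q: abelian_group "quotient N"
    by (rule abelian_group_quotient)
  show ?thesis
    using assms
  proof (induction I rule: finite_induct)
    case empty
    then show ?case
      by (simp add: zero_quotient zero_fun_def)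
  next
    case (insert i I)
    have "(\<Oplus>\<^bsub>quotient N\<^esub>i\<in>insert i I. coset N (F i))
        = coset N (F i) \<oplus>\<^bsub>quotient N\<^esub> (\<Oplus>\<^bsub>quotient N\<^esub>i\<in>I. coset N (F i))"
      using insert by (intro Q.finsum_insert) (auto simp: carrier_quotient)
    also have "\<dots> = coset N (F i + (\<Sum>i\<in>I. F i))"
      using insert by (simp add: add_coset subfam_sum[OF subfam_families])
    finally show ?case
      by (simp only: sum.insert[OF insert(1,2)])
  qed
qed

text \<open>Rationality data \<open>ms\<close>, \<open>cs\<close> yield the finite set of the
  \<open>cs i\<close>. Conversely, for an independent \<open>B\<close> with dual functionals
  \<open>e i\<close>, subtracting from \<open>f\<close> the multiples \<open>f (cs i)\<close> of the
  \<open>e i\<close> gives an element that kills \<open>B\<close>, so \<open>f\<close> acts on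
  \<open>F\<close> like their sum.\<close>

lemma coset_rational_iff:
  assumes F: "F \<in> families"
  shows "coset N F \<in> rational_part scale \<Delta> \<epsilon> (quotient N) \<longleftrightarrow> F \<in> rat N"
proof
  assume "coset N F \<in> rational_part scale \<Delta> \<epsilon> (quotient N)"
  then obtain n :: nat and ms cs where ms: "\<forall>i<n. ms i \<in> carrier (quotient N)"
    and eq: "\<forall>f\<in>dual_space. coset N F \<cdot>\<^bsub>quotient N\<^esub> f
      = (\<Oplus>\<^bsub>quotient N\<^esub>i\<in>{..<n}. ms i \<cdot>\<^bsub>quotient N\<^esub> (\<lambda>c. f (cs i) * \<epsilon> c))"
    by (auto simp: rational_part_def dual_ring_simps)
  have "\<forall>i\<in>{..<n}. \<exists>G. G \<in> families \<and> ms i = coset N G"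
    using ms by (auto simp: carrier_quotient)
  from bchoice[OF this] obtain G where G: "\<forall>i\<in>{..<n}. G i \<in> families \<and> ms i = coset N (G i)"
    by blast
  have "act F h \<in> N" if h: "h \<in> ann (cs ` {..<n})" for h
  proof -
    have "coset N (act F h) = coset N F \<cdot>\<^bsub>quotient N\<^esub> h"
      using F ann_dual[OF h] by (simp add: ract_coset)
    also have "\<dots> = (\<Oplus>\<^bsub>quotient N\<^esub>i\<in>{..<n}. ms i \<cdot>\<^bsub>quotient N\<^esub> (\<lambda>c. h (cs i) * \<epsilon> c))"
      using eq ann_dual[OF h] by blast
    also have "\<dots> = (\<Oplus>\<^bsub>quotient N\<^esub>i\<in>{..<n}. coset N (0 :: 'x \<Rightarrow> 'c \<Rightarrow> 'k))"
    proof (rule abelian_monoid.finsum_cong')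
      show "abelian_monoid (quotient N)"
        using abelian_group_quotient by (rule abelian_group.axioms)
      fix i
      assume i: "i \<in> {..<n}"
      then have "h (cs i) = 0"
        using h by (simp add: ann_def)
      then have "(\<lambda>c. h (cs i) * \<epsilon> c) = 0"
        by (simp add: fun_eq_iff)
      then show "ms i \<cdot>\<^bsub>quotient N\<^esub> (\<lambda>c. h (cs i) * \<epsilon> c) = coset N 0"
        using G i ract_coset[of "G i" 0] dual_closed(4)
        by (simp add: act_zero)
    qed (use subfamD(2)[OF subfam_families] in \<open>auto simp: carrier_quotient\<close>)
    also have "\<dots> = coset N 0"
      using finsum_coset[of "{..<n}" "\<lambda>i. 0"] subfamD(2)[OF subfam_families] by simp
    finally show ?thesis
      using coset_eq_iff[of "act F h" 0] F ann_dual[OF h] subfamD(4)[OF subfam_families] by auto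
  qed
  then show "F \<in> rat N"
    using F unfolding rat_def by (intro CollectI conjI exI[of _ "cs ` {..<n}"]) auto
next
  assume "F \<in> rat N"
  then obtain B0 where B0: "finite B0" "\<forall>h\<in>ann B0. act F h \<in> N"
    by (auto simp: rat_def)
  \<comment> \<open>Independence allows dual functionals; a basis of the span of \<open>B0\<close>
    has the same annihilator as \<open>B0\<close>.\<close>
  obtain B where B: "finite B" "independent B" "span B = span B0"
    using fin_dim_basis[OF fin_dim_span_finite[OF B0(1)] subspace_span] .
  have ann: "ann B = ann B0"
    using ann_span[of B] ann_span[of B0] B(3) by simp
  obtain cs where cs: "bij_betw cs {..<card B} B"
    using ex_bij_betw_nat_finite[OF B(1)] by (auto simp: atLeast0LessThan)
  have "\<forall>i. \<exists>e. e \<in> dual_space \<and> (\<forall>b\<in>B. e b = (if b = cs i then 1 else 0))"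
  proof
    fix i
    obtain e where "e \<in> dual_space" "\<forall>b\<in>B. e b = (if b = cs i then 1 else 0)"
      by (rule extend_functional[OF B(2)])
    then show "\<exists>e. e \<in> dual_space \<and> (\<forall>b\<in>B. e b = (if b = cs i then 1 else 0))"
      by blast
  qed
  from choice[OF this] obtain e
    where e: "\<And>i. e i \<in> dual_space" "\<And>i b. b \<in> B \<Longrightarrow> e i b = (if b = cs i then 1 else 0)"
    by blast
  let ?r = "\<lambda>f i c. f (cs i) * \<epsilon> c"
  have fam: "act F (e i) \<in> families" for i
    using F e(1) subfamD(4)[OF subfam_families] by blast
  have rd: "?r f i \<in> dual_space" for f i
    by (rule dual_closed(5)[OF counit_dual])
  have fam': "act (act F (e i)) (?r f i) \<in> families" for f i
    using subfamD(4)[OF subfam_families fam rd] .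
  have "coset N F \<cdot>\<^bsub>quotient N\<^esub> f
      = (\<Oplus>\<^bsub>quotient N\<^esub>i\<in>{..<card B}. coset N (act F (e i)) \<cdot>\<^bsub>quotient N\<^esub> ?r f i)"
    if f: "f \<in> dual_space" for f
  proof -
    define g where "g = f - (\<Sum>i<card B. (\<lambda>c. f (cs i) * e i c))"
    have g_apply: "g c = f c - (\<Sum>i<card B. f (cs i) * e i c)" for c
      by (simp add: g_def sum_fun_apply)
    have g_dual: "g \<in> dual_space"
      unfolding g_def using f e(1) by (intro dual_closed(2) dual_sum_closed dual_closed(5)) auto
    have "g b = 0" if b: "b \<in> B" for b
    proof -
      obtain j where j: "j < card B" "b = cs j"
        using b cs by (auto simp: bij_betw_def)
      have "f (cs i) * e i b = (if i = j then f b else 0)" if "i < card B" for i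
        using e(2)[OF b, of i] cs that j by (auto simp: bij_betw_def inj_on_def)
      then have "(\<Sum>i<card B. f (cs i) * e i b) = (\<Sum>i<card B. if i = j then f b else 0)"
        by (intro sum.cong) auto
      then show ?thesis
        using j by (simp add: g_apply)
    qed
    then have "g \<in> ann B0"
      using g_dual ann by (auto simp: ann_def)
    then have "act F g \<in> N"
      using B0(2) by blast
    also have "act F g = act F f - (\<Sum>i<card B. act (act F (e i)) (?r f i))"
    proof (intro ext)
      fix j c
      have "act F g j c = g (rhit (F j) c)"
        using g_dual by (simp add: act_def conv_eq_rhit)
      also have "\<dots> = f (rhit (F j) c) - (\<Sum>i<card B. f (cs i) * e i (rhit (F j) c))"
        by (rule g_apply)
      also have "\<dots> = (act F f - (\<Sum>i<card B. act (act F (e i)) (?r f i))) j c"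
        using f e(1) familiesD[OF F]
        by (simp add: act_def sum_fun_apply conv_scaled_counit conv_dual conv_eq_rhit[symmetric])
      finally show "act F g j c = (act F f - (\<Sum>i<card B. act (act F (e i)) (?r f i))) j c" .
    qed
    finally have "coset N (act F f) = coset N (\<Sum>i<card B. act (act F (e i)) (?r f i))"
      by (rule coset_eqI)
    also have "\<dots> = (\<Oplus>\<^bsub>quotient N\<^esub>i\<in>{..<card B}. coset N (act (act F (e i)) (?r f i)))"
      using fam' by (intro finsum_coset[symmetric]) auto
    finally show ?thesis
      using F f fam rd by (simp add: ract_coset)
  qed
  then show "coset N F \<in> rational_part scale \<Delta> \<epsilon> (quotient N)"
    using F fam unfolding rational_part_def dual_ring_simps
    by (intro CollectI conjI exI[of _ "card B"] exI[of _ "\<lambda>i. coset N (act F (e i))"] exI[of _ cs])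
      (auto simp: carrier_quotient)
qed

text \<open>\<open>Q\<close> is the preimage of a complement of the rational part, which restates
  the splitting without cosets.\<close>

lemma complement_of_rat:
  assumes "direct_summand dual_ring (quotient N) (rational_part scale \<Delta> \<epsilon> (quotient N))"
  obtains Q where "subfam Q" "Q \<inter> rat N = N" "\<forall>F\<in>families. \<exists>q\<in>Q. \<exists>t\<in>rat N. F = q + t"
proof -
  let ?M = "quotient N" and ?T = "rational_part scale \<Delta> \<epsilon> (quotient N)"
  obtain P where P: "right_submodule dual_ring ?M P" "?T \<inter> P = {\<zero>\<^bsub>?M\<^esub>}"
    "?T <+>\<^bsub>?M\<^esub> P = carrier ?M"
    using assms by (auto simp: direct_summand_def)
  interpret P: subgroup P "add_monoid ?M"
    using P(1) by (simp add: right_submodule_def)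
  define Q where "Q = {F \<in> families. coset N F \<in> P}"
  have "subfam Q"
    unfolding subfam_def
  proof (intro conjI ballI)
    show "0 \<in> Q"
      using P.one_closed by (simp add: Q_def zero_quotient subfamD(2)[OF subfam_families])
    show "F + G \<in> Q" if "F \<in> Q" "G \<in> Q" for F G
      using that P.m_closed[of "coset N F" "coset N G"]
      by (simp add: Q_def add_coset families_closed)
    show "act F a \<in> Q" if "F \<in> Q" "a \<in> dual_space" for F a
    proof -
      have "coset N F \<cdot>\<^bsub>?M\<^esub> a \<in> P"
        using P(1) that by (simp add: right_submodule_def dual_ring_simps Q_def)
      then show ?thesis
        using that by (simp add: Q_def ract_coset families_closed)
    qed
  qed (auto simp: Q_def)
  moreover have "Q \<inter> rat N = N"
  proof (intro equalityI subsetI)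
    fix F
    assume F: "F \<in> Q \<inter> rat N"
    then have "coset N F \<in> ?T \<inter> P" "F \<in> families"
      by (auto simp: Q_def coset_rational_iff)
    then show "F \<in> N"
      using P(2) coset_eq_iff[of F 0] by (simp add: zero_quotient)
  next
    fix F
    assume F: "F \<in> N"
    then have "coset N F = coset N 0"
      by (intro coset_eqI) simp
    then have "coset N F \<in> P"
      using P.one_closed by (simp add: zero_quotient)
    then show "F \<in> Q \<inter> rat N"
      using F subfamD(1)[OF N] subfam_rat(2)[OF N] by (auto simp: Q_def)
  qed
  moreover have "\<exists>q\<in>Q. \<exists>t\<in>rat N. F = q + t" if F: "F \<in> families" for F
  proof -
    have "coset N F \<in> ?T <+>\<^bsub>?M\<^esub> P"
      using F P(3) by (simp add: carrier_quotient)
    then obtain U V where UV: "U \<in> ?T" "V \<in> P" "coset N F = U \<oplus>\<^bsub>?M\<^esub> V"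
      by (auto simp: set_add_def')
    then have "U \<in> carrier ?M" "V \<in> carrier ?M"
      using P.subset by (auto simp: rational_part_def)
    then obtain t q where t: "t \<in> families" "U = coset N t" and q: "q \<in> families" "V = coset N q"
      by (auto simp: carrier_quotient)
    have "F - (t + q) \<in> N"
      using UV(3) t q F by (simp add: add_coset coset_eq_iff)
    moreover have "t \<in> rat N"
      using UV(1) t coset_rational_iff by simp
    \<comment> \<open>The error in \<open>N\<close> left by the equation of cosets is absorbed into
      the rational summand.\<close>
    ultimately have "F - q \<in> rat N"
      using subfamD(3)[OF subfam_rat(1)[OF N], of "F - (t + q)" t] subfam_rat(2)[OF N]
      by (auto simp: algebra_simps)
    then show ?thesis
      using q UV(2) by (intro bexI[of _ q] bexI[of _ "F - q"]) (auto simp: Q_def)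
  qed
  ultimately show thesis
    using that by blast
qed

end

end

section \<open>Coalgebras all of whose rational parts split off\<close>

lemma (in vector_space) linear_span_in:
  assumes "Vector_Spaces.linear scale scale T" "subspace V" "\<And>s. s \<in> S \<Longrightarrow> T s \<in> V" "x \<in> span S"
  shows "T x \<in> V"
proof -
  interpret T: Vector_Spaces.linear scale scale T by fact
  show ?thesis
    using assms(4)
    by (induction rule: span_induct_alt)
      (use assms in \<open>simp_all add: T.zero T.add T.scale subspace_0 subspace_add subspace_scale\<close>)
qed

context coalgebra
begin

section \<open>One-sided submodules and wedge powers\<close>

lemma lsub_subspace: "lsub S \<Longrightarrow> subspace S"
  and lsubD: "lsub S \<Longrightarrow> h \<in> dual_space \<Longrightarrow> c \<in> S \<Longrightarrow> lhit h c \<in> S"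
  by (simp_all add: lsub_def)

lemma rsubD: "rsub S \<Longrightarrow> h \<in> dual_space \<Longrightarrow> c \<in> S \<Longrightarrow> rhit h c \<in> S"
  by (simp add: rsub_def)

lemma rhit_ann_lsub:
  assumes "lsub S" "f \<in> ann S" "c \<in> S"
  shows "rhit f c = 0"
proof (rule dual_separates)
  fix h
  assume "h \<in> dual_space"
  then show "h (rhit f c) = h 0"
    using assms lsubD[of S h c] by (simp add: pairing[symmetric] ann_def dual_0)
qed

lemma lhit_ann_rsub:
  assumes "rsub S" "f \<in> ann S" "c \<in> S"
  shows "lhit f c = 0"
proof (rule dual_separates)
  fix h
  assume "h \<in> dual_space"
  then show "h (lhit f c) = h 0"
    using assms rsubD[of S h c] by (simp add: pairing ann_def dual_0)
qed

text \<open>Used to conclude that \<open>h\<close> vanishes wherever \<open>lhit h\<close>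
  does.\<close>

lemma counit_lhit: "h \<in> dual_space \<Longrightarrow> \<epsilon> (lhit h c) = h c"
  by (simp add: pairing counit_dual rhit_counit)

lemma counit_rhit: "h \<in> dual_space \<Longrightarrow> \<epsilon> (rhit h c) = h c"
  by (simp add: pairing[symmetric] counit_dual lhit_counit)

lemma conv_ann_lsub: "lsub S \<Longrightarrow> f \<in> ann S \<Longrightarrow> g \<in> dual_space \<Longrightarrow> conv f g \<in> ann S"
  by (auto simp: ann_def conv_dual conv_eq_lhit lsub_def)

lemma conv_ann_rsub: "rsub S \<Longrightarrow> g \<in> ann S \<Longrightarrow> f \<in> dual_space \<Longrightarrow> conv f g \<in> ann S"
  by (auto simp: ann_def conv_dual conv_eq_rhit rsub_def)

lemma lhit_scale_left: "lhit (\<lambda>c. r * h c) c = scale r (lhit h c)"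
proof -
  have "(\<lambda>(a, b). scale (r * h b) a) = (\<lambda>p. scale r (case p of (a, b) \<Rightarrow> scale (h b) a))"
    by auto
  then show ?thesis
    by (simp add: lhit_def lin_ext_scale_fun)
qed

lemma lsub_lorbit: "lsub {lhit h c |h. h \<in> dual_space}"
proof -
  have "subspace {lhit h c |h. h \<in> dual_space}"
  proof (rule subspaceI)
    have "0 = lhit (\<lambda>c. 0 * \<epsilon> c) c"
      by (simp only: lhit_scale_left scale_zero_left)
    then show "0 \<in> {lhit h c |h. h \<in> dual_space}"
      using dual_closed(5)[OF counit_dual] by blast
  next
    fix x y
    assume "x \<in> {lhit h c |h. h \<in> dual_space}" "y \<in> {lhit h c |h. h \<in> dual_space}"
    then show "x + y \<in> {lhit h c |h. h \<in> dual_space}"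
      by (auto simp: lhit_add_left[symmetric] intro: dual_closed)
  next
    fix r x
    assume "x \<in> {lhit h c |h. h \<in> dual_space}"
    then show "scale r x \<in> {lhit h c |h. h \<in> dual_space}"
      by (auto simp: lhit_scale_left[symmetric] intro: dual_closed)
  qed
  moreover have "lhit g (lhit h c) \<in> {lhit h c |h. h \<in> dual_space}"
    if "g \<in> dual_space" "h \<in> dual_space" for g h
    using that conv_dual by (auto simp: lhit_conv[symmetric])
  ultimately show ?thesis
    by (auto simp: lsub_def)
qed

lemma lorbit_self: "c \<in> {lhit h c |h. h \<in> dual_space}"
  using lhit_counit[of c] counit_dual by force

lemma lsub_sums:
  assumes "lsub S" "lsub T"
  shows "lsub {x + y |x y. x \<in> S \<and> y \<in> T}"
proof -
  have "lhit h (x + y) \<in> {x + y |x y. x \<in> S \<and> y \<in> T}"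
    if "h \<in> dual_space" "x \<in> S" "y \<in> T" for h x y
    unfolding mem_Collect_eq using that lsubD[OF assms(1)] lsubD[OF assms(2)]
    by (intro exI[of _ "lhit h x"] exI[of _ "lhit h y"]) (simp add: lhit_add)
  then show ?thesis
    using subspace_sums[of S T] assms by (auto simp: lsub_def)
qed

lemma lsub_UN_chain:
  fixes D :: "nat \<Rightarrow> 'c set"
  assumes "incseq D" "\<And>n. lsub (D n)"
  shows "lsub (\<Union>n. D n)"
  using subspace_UN_chain[OF assms(1)] assms(2) by (auto simp: lsub_def)

lemma lsub_zero: "lsub {0}"
  by (auto simp: lsub_def lhit_0)

lemma lsub_UNIV: "lsub UNIV"
  by (simp add: lsub_def)

text \<open>
  If \<open>D\<close> is a subcoalgebra, then \<open>wedge D n\<close> is the wedge power \<open>D \<and> \<dots> \<and> D\<close> with \<open>n\<close> factors, so that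
  \<open>wedge D 1 = D\<close>.
\<close>

primrec wedge :: "'c set \<Rightarrow> nat \<Rightarrow> 'c set" where
  "wedge D 0 = {0}"
| "wedge D (Suc n) = {c. \<forall>h\<in>ann D. lhit h c \<in> wedge D n}"

text \<open>Products of \<open>n\<close> elements of \<open>G\<close>. New letters enter on the
  right because \<open>lhit (conv w g)\<close> applies \<open>lhit g\<close> first, as in the
  recursion of \<open>wedge\<close>.\<close>

primrec words :: "('c \<Rightarrow> 'k) set \<Rightarrow> nat \<Rightarrow> ('c \<Rightarrow> 'k) set" where
  "words G 0 = {\<epsilon>}"
| "words G (Suc n) = (\<lambda>(w, g). conv w g) ` (words G n \<times> G)"

lemma finite_words: "finite G \<Longrightarrow> finite (words G n)"
  by (induction n) auto

lemma words_dual: "G \<subseteq> dual_space \<Longrightarrow> words G n \<subseteq> dual_space"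
  by (induction n) (auto simp: counit_dual intro: conv_dual)

lemma subspace_wedge: "subspace (wedge D n)"
proof (induction n)
  case (Suc n)
  then show ?case
    by (auto simp: subspace_def ann_dual lhit_0 lhit_add lhit_scale)
qed simp

context
  fixes D
  assumes lsub: "lsub D" and rsub: "rsub D"
begin

lemma lsub_wedge: "lsub (wedge D n)"
proof -
  have "lhit a c \<in> wedge D n" if a: "a \<in> dual_space" and c: "c \<in> wedge D n" for a c
  proof (cases n)
    case (Suc m)
    \<comment> \<open>\<open>conv h a\<close> is again in \<open>ann D\<close>, which is a right
      ideal because \<open>D\<close> is stable under \<open>lhit\<close>.\<close>
    have "lhit h (lhit a c) \<in> wedge D m" if "h \<in> ann D" for h
      using c conv_ann_lsub[OF lsub that a] lhit_conv[OF ann_dual[OF that] a] Suc by force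
    then show ?thesis
      using Suc by simp
  qed (use a c in \<open>simp add: lhit_0\<close>)
  then show ?thesis
    using subspace_wedge by (simp add: lsub_def)
qed

lemma rsub_wedge: "rsub (wedge D n)"
proof -
  have "rhit f c \<in> wedge D n" if "f \<in> dual_space" "c \<in> wedge D n" for f c
    using that
  proof (induction n arbitrary: c)
    case (Suc n)
    then show ?case
      by (simp add: lhit_rhit_commute ann_dual)
  qed (simp add: rhit_0)
  then show ?thesis
    using subspace_wedge by (simp add: rsub_def)
qed

lemma incseq_wedge: "incseq (wedge D)"
proof (rule incseq_SucI)
  show "wedge D n \<subseteq> wedge D (Suc n)" for n
    using lsubD[OF lsub_wedge] ann_dual by auto
qed

lemma wedge_1: "wedge D (Suc 0) = D"
proof (intro equalityI subsetI)
  fix c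
  assume c: "c \<in> wedge D (Suc 0)"
  show "c \<in> D"
  proof (rule ccontr)
    assume "c \<notin> D"
    then obtain h where h: "h \<in> ann D" "h c = 1"
      using ann_separates[OF lsub_subspace[OF lsub]] by blast
    then show False
      using c counit_lhit[OF ann_dual[OF h(1)], of c] dual_0[OF counit_dual] by simp
  qed
qed (simp add: lhit_ann_rsub[OF rsub])

text \<open>The filtration is defined with \<open>lhit\<close> but behaves in the same way under
  \<open>rhit\<close>; commutation of the actions carries the induction, and \<open>wedge_1\<close>
  starts it.\<close>

lemma rhit_ann_wedge: "f \<in> ann D \<Longrightarrow> c \<in> wedge D (Suc n) \<Longrightarrow> rhit f c \<in> wedge D n"
proof (induction n arbitrary: c)
  case 0
  then show ?case
    using rhit_ann_lsub[OF lsub] wedge_1 by auto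
next
  case (Suc n)
  then have "rhit f (lhit h c) \<in> wedge D n" if "h \<in> ann D" for h
    using that by simp
  then show ?case
    using Suc.prems(1) by (simp add: lhit_rhit_commute ann_dual)
qed

text \<open>Every element lies in a finite dimensional left submodule; induct on the size of a
  spanning set of one. If it is not exhausted, take \<open>\<phi>\<close> that kills the union but
  not \<open>u0\<close>. The kernel \<open>K\<close> of \<open>rhit \<phi>\<close> is smaller, hence
  inside some \<open>wedge D m\<close>, and the image, a nonzero left submodule, meets
  \<open>D\<close> in some \<open>rhit \<phi> u \<noteq> 0\<close>. Then \<open>ann D\<close> moves
  \<open>u\<close> into \<open>K\<close>, so \<open>u\<close> lies in the next wedge power, where
  \<open>rhit \<phi>\<close> vanishes.\<close>

lemma wedge_exhausts:
  assumes ess: "\<And>W. lsub W \<Longrightarrow> W \<noteq> {0} \<Longrightarrow> W \<inter> D \<noteq> {0}"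
  shows "(\<Union>n. wedge D n) = UNIV"
proof -
  let ?F = "\<Union>n. wedge D n"
  have lF: "lsub ?F"
    by (rule lsub_UN_chain[OF incseq_wedge lsub_wedge])
  have fin: "span B \<subseteq> ?F" if "finite B" "lsub (span B)" for B
    using that
  proof (induction "card B" arbitrary: B rule: less_induct)
    case less
    show ?case
    proof (rule ccontr)
      assume "\<not> span B \<subseteq> ?F"
      then obtain u0 where u0: "u0 \<in> span B" "u0 \<notin> ?F"
        by blast
      obtain \<phi> where \<phi>: "\<phi> \<in> ann ?F" "\<phi> u0 = 1"
        using ann_separates[OF lsub_subspace[OF lF] u0(2)] by blast
      note \<phi>d = ann_dual[OF \<phi>(1)]
      define K where "K = {u \<in> span B. rhit \<phi> u = 0}"
      have lK: "lsub K"
        using less.prems(2) \<phi>d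
        by (auto simp: K_def lsub_def subspace_def rhit_0 rhit_add rhit_scale lhit_0
            lhit_rhit_commute[symmetric])
      have "fin_dim K"
        using fin_dim_mono[OF fin_dim_span_finite[OF less.prems(1)]] by (auto simp: K_def)
      then obtain B' where B': "finite B'" "independent B'" "span B' = K"
        using fin_dim_basis lsub_subspace[OF lK] by blast
      have "rhit \<phi> u0 \<noteq> 0"
        using counit_rhit[OF \<phi>d, of u0] \<phi>(2) dual_0[OF counit_dual] by auto
      then have u0K: "u0 \<notin> K"
        by (simp add: K_def)
      then have "independent (insert u0 B')"
        using B' by (intro independent_insertI) auto
      moreover have "insert u0 B' \<subseteq> span B"
        using u0(1) B'(3) span_superset[of B'] by (auto simp: K_def)
      ultimately have "card (insert u0 B') \<le> card B"
        using independent_span_bound[OF less.prems(1)] by blast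
      moreover have "u0 \<notin> B'"
        using u0K B'(3) span_superset[of B'] by auto
      ultimately have "card B' < card B"
        using B'(1) by simp
      then have "K \<subseteq> ?F"
        using less.hyps[of B'] B' lK by simp
      then obtain m where m: "K \<subseteq> wedge D m"
        using fin_dim_subset_chain[OF incseq_wedge subspace_wedge \<open>fin_dim K\<close> lsub_subspace[OF lK]]
        by blast
      have "lsub (rhit \<phi> ` span B)"
        unfolding lsub_def
      proof (intro conjI ballI)
        show "subspace (rhit \<phi> ` span B)"
          using linear_rhit[OF \<phi>d] by (intro module_hom.subspace_image) (auto simp: module_hom_iff_linear)
        fix h c
        assume "h \<in> dual_space" "c \<in> rhit \<phi> ` span B"
        then show "lhit h c \<in> rhit \<phi> ` span B"
          using less.prems(2) \<phi>d by (auto simp: lhit_rhit_commute lsub_def)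
      qed
      moreover have "rhit \<phi> ` span B \<noteq> {0}"
        using \<open>rhit \<phi> u0 \<noteq> 0\<close> u0(1) by auto
      ultimately have "rhit \<phi> ` span B \<inter> D \<noteq> {0}"
        by (rule ess)
      moreover have "0 \<in> rhit \<phi> ` span B \<inter> D"
        using rhit_0[OF \<phi>d] span_zero[of B] subspace_0[OF lsub_subspace[OF lsub]] by force
      ultimately obtain u where u: "u \<in> span B" "rhit \<phi> u \<in> D" "rhit \<phi> u \<noteq> 0"
        by blast
      have "lhit h u \<in> wedge D m" if h: "h \<in> ann D" for h
      proof -
        have "rhit \<phi> (lhit h u) = 0"
          using lhit_ann_rsub[OF rsub h u(2)] \<phi>d ann_dual[OF h] by (simp add: lhit_rhit_commute)
        then have "lhit h u \<in> K"
          using u(1) less.prems(2) ann_dual[OF h] by (simp add: K_def lsub_def)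
        then show ?thesis
          using m by blast
      qed
      then have "u \<in> wedge D (Suc m)"
        by simp
      then have "u \<in> ?F"
        by blast
      then show False
        using rhit_ann_lsub[OF lF \<phi>(1)] u(3) by blast
    qed
  qed
  have "c \<in> ?F" for c
  proof -
    obtain B where B: "finite B" "span B = {lhit h c |h. h \<in> dual_space}"
      by (rule fin_dim_basis[OF fin_dim_lorbit lsub_subspace[OF lsub_lorbit]])
    have "span B \<subseteq> ?F"
      by (rule fin[OF B(1)]) (simp only: B(2) lsub_lorbit)
    then show ?thesis
      using lorbit_self[of c] unfolding B(2) by blast
  qed
  then show ?thesis
    by blast
qed

section \<open>Finite generation of annihilators of wedge powers\<close>

text \<open>\<open>G\<close> is chosen to cut out \<open>D\<close> inside \<open>wedge D 2\<close>
  only. That suffices: induction along the wedge filtration shows that a vector killed by all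
  \<open>lhit g\<close> lies in \<open>D\<close>, so every functional in \<open>ann D\<close>
  vanishes there and factors through the maps \<open>lhit g\<close>.\<close>

lemma generators:
  assumes fin2: "fin_dim (wedge D 2)" and exh: "(\<Union>n. wedge D n) = UNIV"
  obtains G where "finite G" "G \<subseteq> ann D"
    "\<forall>h\<in>ann D. \<exists>a. (\<forall>g\<in>G. a g \<in> dual_space) \<and> (\<forall>z. h z = (\<Sum>g\<in>G. a g (lhit g z)))"
proof -
  obtain G where G: "finite G" "G \<subseteq> ann D" "\<forall>w\<in>wedge D 2. (\<forall>g\<in>G. g w = 0) \<longrightarrow> w \<in> D"
    by (rule finite_ann_separates[OF fin2 lsub_subspace[OF lsub]])
  have Gd: "g \<in> dual_space" if "g \<in> G" for g
    using G(2) that ann_dual by blast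
  have key: "c \<in> D" if "\<forall>g\<in>G. lhit g c = 0" "c \<in> wedge D n" for c n
    using that
  proof (induction n arbitrary: c)
    case 0
    then show ?case
      using subspace_0[OF lsub_subspace[OF lsub]] by simp
  next
    case (Suc n)
    have r: "rhit f c \<in> D" if f: "f \<in> ann D" for f
    proof (rule Suc.IH)
      show "rhit f c \<in> wedge D n"
        by (rule rhit_ann_wedge[OF f Suc.prems(2)])
      show "\<forall>g\<in>G. lhit g (rhit f c) = 0"
        using Suc.prems(1) Gd ann_dual[OF f] by (simp add: lhit_rhit_commute rhit_0)
    qed
    \<comment> \<open>Paired with \<open>g\<close>, this becomes \<open>h\<close> evaluated at
      \<open>rhit (conv g h') c\<close>. As \<open>ann D\<close> is a left ideal, it contains
      \<open>conv g h'\<close>, and the induction hypothesis puts that vector into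
      \<open>D\<close>.\<close>
    have "lhit h' (lhit h c) = 0" if h: "h \<in> ann D" "h' \<in> ann D" for h h'
    proof (rule dual_separates)
      fix g
      assume g: "g \<in> dual_space"
      have gh: "conv g h' \<in> ann D"
        using conv_ann_rsub[OF rsub h(2) g] .
      have "g (lhit h' (lhit h c)) = conv g h' (lhit h c)"
        using g by (simp add: conv_eq_lhit)
      also have "\<dots> = h (rhit (conv g h') c)"
        using pairing[OF ann_dual[OF gh] ann_dual[OF h(1)]] .
      also have "\<dots> = 0"
        using r[OF gh] h(1) by (simp add: ann_def)
      finally show "g (lhit h' (lhit h c)) = g 0"
        using g by (simp add: dual_0)
    qed
    then have "c \<in> wedge D 2"
      by (simp add: numeral_2_eq_2)
    moreover have "g c = 0" if "g \<in> G" for g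
      using counit_lhit[OF Gd[OF that], of c] Suc.prems(1) that dual_0[OF counit_dual] by simp
    ultimately show ?case
      using G(3) by blast
  qed
  have "\<exists>a. (\<forall>g\<in>G. a g \<in> dual_space) \<and> (\<forall>z. h z = (\<Sum>g\<in>G. a g (lhit g z)))" if h: "h \<in> ann D" for h
  proof (rule factor_functional_finite[OF G(1) ann_dual[OF h]])
    show "Vector_Spaces.linear scale scale (lhit g)" if "g \<in> G" for g
      by (rule linear_lhit[OF Gd[OF that]])
    fix z
    assume "\<And>g. g \<in> G \<Longrightarrow> lhit g z = 0"
    moreover obtain n where "z \<in> wedge D n"
      using exh by blast
    ultimately show "h z = 0"
      using key annD[OF h] by blast
  qed
  then show thesis
    using that G by blast
qed

text \<open>An \<open>h\<close> in \<open>ann D\<close> is a combination of the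
  \<open>conv (a g) g\<close>, and wedge powers are stable under \<open>lhit (a g)\<close>; so in
  the recursion of \<open>wedge\<close> only the generators need to be tested. As
  \<open>words G n\<close> is finite, \<open>factor_functional_finite\<close> becomes
  applicable.\<close>

lemma wedge_eq_words:
  assumes G: "finite G" "G \<subseteq> ann D"
    and gen: "\<forall>h\<in>ann D. \<exists>a. (\<forall>g\<in>G. a g \<in> dual_space) \<and> (\<forall>z. h z = (\<Sum>g\<in>G. a g (lhit g z)))"
  shows "wedge D n = {c. \<forall>w\<in>words G n. lhit w c = 0}"
proof (induction n)
  case 0
  then show ?case
    by (simp add: lhit_counit)
next
  case (Suc n)
  have Gd: "g \<in> dual_space" if "g \<in> G" for g
    using G(2) that ann_dual by blast
  have wd: "w \<in> dual_space" if "w \<in> words G n" for w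
    using words_dual[of G n] Gd that by blast
  have "lhit h c \<in> wedge D n" if c: "\<forall>g\<in>G. lhit g c \<in> wedge D n" and h: "h \<in> ann D" for h c
  proof -
    obtain a where a: "\<forall>g\<in>G. a g \<in> dual_space" "\<forall>z. h z = (\<Sum>g\<in>G. a g (lhit g z))"
      using gen h by blast
    have "h = (\<Sum>g\<in>G. conv (a g) g)"
      using a by (simp add: fun_eq_iff sum_fun_apply conv_eq_lhit)
    then have "lhit h c = (\<Sum>g\<in>G. lhit (conv (a g) g) c)"
      by (simp only: lhit_sum_left)
    also have "\<dots> = (\<Sum>g\<in>G. lhit (a g) (lhit g c))"
      using a(1) Gd by (simp add: lhit_conv)
    also have "\<dots> \<in> wedge D n"
      using a(1) c lsubD[OF lsub_wedge] by (intro subspace_sum[OF subspace_wedge]) blast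
    finally show ?thesis .
  qed
  then have "wedge D (Suc n) = {c. \<forall>g\<in>G. lhit g c \<in> wedge D n}"
    using G(2) by auto
  also have "\<dots> = {c. \<forall>w\<in>words G n. \<forall>g\<in>G. lhit w (lhit g c) = 0}"
    using Suc by auto
  also have "\<dots> = {c. \<forall>w\<in>words G (Suc n). lhit w c = 0}"
    using wd Gd by (auto simp: lhit_conv)
  finally show ?case .
qed

end

end

section \<open>Finiteness consequences of splitting\<close>

text \<open>The module hypothesis restated for submodules of families. The index type is the one for
  which cosets of families inhabit the carrier type of the theorem.\<close>

locale splitting_coalgebra = coalgebra scale \<Delta> \<epsilon>
  for scale :: "'k::field \<Rightarrow> 'c::ab_group_add \<Rightarrow> 'c" and \<Delta> \<epsilon> +
  assumes split: "\<And>N :: (('c \<Rightarrow> 'k) \<Rightarrow> 'c \<Rightarrow> 'k) set. subfam N \<Longrightarrow>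
    \<exists>Q. subfam Q \<and> Q \<inter> rat N = N \<and> (\<forall>F\<in>families. \<exists>q\<in>Q. \<exists>t\<in>rat N. F = q + t)"
begin

text \<open>
  Splitting of the cyclic module \<open>C\<^sup>*/Z\<^sup>\<bottom>\<close>: its rational elements, the cosets of the
  functionals \<open>f\<close> with \<open>fin_dim (rhit f ` Z)\<close>, form a finite dimensional space.
\<close>

lemma cyclic_splitting:
  assumes Z: "lsub Z"
  obtains B where "finite B"
    "\<forall>z\<in>Z. \<exists>b\<in>span B. \<forall>f\<in>dual_space. fin_dim (rhit f ` Z) \<longrightarrow> f z = f b"
proof -
  \<comment> \<open>An arbitrary index: as \<open>N\<close> constrains only this component,
    \<open>families\<close> modulo \<open>N\<close> is the dual algebra modulo
    \<open>ann Z\<close>.\<close>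
  define i0 :: "'c \<Rightarrow> 'k" where "i0 = 0"
  define N where "N = {F \<in> families. \<forall>z\<in>Z. F i0 z = 0}"
  have N: "subfam N"
    using lsubD[OF Z]
    by (auto simp: N_def subfam_def families_closed act_def families_def dual_closed conv_dual conv_eq_lhit)
  obtain Q where Q: "subfam Q" "Q \<inter> rat N = N" "\<forall>F\<in>families. \<exists>q\<in>Q. \<exists>t\<in>rat N. F = q + t"
    using split[OF N] by blast
  \<comment> \<open>The generator. If \<open>one = q + t\<close> and \<open>f\<close> is rational,
    then \<open>f = q f + t f\<close> puts \<open>q f\<close> into both \<open>Q\<close> and
    \<open>rat N\<close>, so \<open>f\<close> agrees with \<open>t f\<close> on \<open>Z\<close>;
    the required \<open>b\<close> is therefore \<open>rhit (t i0) z\<close>.\<close>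
  define one :: "('c \<Rightarrow> 'k) \<Rightarrow> 'c \<Rightarrow> 'k" where "one = (\<lambda>i. \<epsilon>)"
  have "one \<in> families"
    by (simp add: one_def families_def counit_dual)
  then obtain q t where q: "q \<in> Q" and t: "t \<in> rat N" and one: "one = q + t"
    using Q(3) by blast
  note qF = subfamD(1)[OF Q(1) q] and tF = subfamD(1)[OF subfam_rat(1)[OF N] t]
  obtain B where B: "finite B" "\<forall>h\<in>ann B. act t h \<in> N"
    using t by (auto simp: rat_def)
  have "\<exists>b\<in>span B. \<forall>f\<in>dual_space. fin_dim (rhit f ` Z) \<longrightarrow> f z = f b" if z: "z \<in> Z" for z
  proof (intro bexI ballI impI)
    show "rhit (t i0) z \<in> span B"
    proof (rule ccontr)
      assume "rhit (t i0) z \<notin> span B"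
      then obtain h where h: "h \<in> ann (span B)" "h (rhit (t i0) z) = 1"
        using ann_separates[OF subspace_span] by blast
      then have "act t h \<in> N"
        using B(2) ann_span by blast
      then have "conv (t i0) h z = 0"
        using z by (simp add: N_def act_def)
      then show False
        using h by (simp add: conv_eq_rhit ann_dual)
    qed
    fix f
    assume f: "f \<in> dual_space" and fin: "fin_dim (rhit f ` Z)"
    define const :: "('c \<Rightarrow> 'k) \<Rightarrow> 'c \<Rightarrow> 'k" where "const = (\<lambda>i. f)"
    have cF: "const \<in> families"
      using f by (simp add: const_def families_def)
    obtain E where E: "finite E" "rhit f ` Z \<subseteq> span E"
      using fin by (auto simp: fin_dim_def)
    \<comment> \<open>The dimension condition enters here: \<open>conv f h v = h (rhit f v)\<close>
      vanishes once \<open>h\<close> kills a finite set whose span contains the image.\<close>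
    have "act const h \<in> N" if h: "h \<in> ann E" for h
    proof -
      have "conv f h v = 0" if "v \<in> Z" for v
      proof -
        have "h \<in> ann (span E)" "rhit f v \<in> span E"
          using h E(2) that ann_span by blast+
        then show ?thesis
          using annD ann_dual[OF h] by (simp add: conv_eq_rhit)
      qed
      then show ?thesis
        using families_closed(3)[OF cF ann_dual[OF h]] by (simp add: N_def act_def const_def)
    qed
    then have "const \<in> rat N"
      using cF E(1) by (auto simp: rat_def)
    moreover have const: "const = act q f + act t f"
    proof -
      have "const = act one f"
        using f by (simp add: const_def act_def one_def conv_counit_left)
      then show ?thesis
        using one qF tF by (simp add: act_add_left)
    qed
    moreover have "act t f \<in> rat N"
      using subfamD(4)[OF subfam_rat(1)[OF N] t f] .
    ultimately have "act q f \<in> rat N"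
      using subfam_minus[OF subfam_rat(1)[OF N], of const "act t f"] by simp
    then have "act q f \<in> N"
      using Q(2) subfamD(4)[OF Q(1) q f] by blast
    then have "act q f i0 z = 0"
      using z by (simp add: N_def)
    then have "f z = act t f i0 z"
      using fun_cong[OF fun_cong[OF const, of i0], of z] by (simp add: const_def)
    then show "f z = f (rhit (t i0) z)"
      using f by (simp add: act_def conv_eq_rhit)
  qed
  then show thesis
    using that B(1) by blast
qed

text \<open>By \<open>cyclic_splitting\<close> each \<open>z\<close> agrees with some
  \<open>b\<close> in \<open>span B\<close> on all functionals that are rational modulo
  \<open>ann Z\<close>; these detect everything outside \<open>Y\<close>, so \<open>z - b\<close> is
  in \<open>Y\<close>.\<close>

lemma fin_dim_if_separated:
  assumes Z: "lsub Z" and Y: "fin_dim Y"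
    and sep: "\<And>v. v \<notin> Y \<Longrightarrow> \<exists>f\<in>dual_space. fin_dim (rhit f ` Z) \<and> f v \<noteq> 0"
  shows "fin_dim Z"
proof -
  obtain B where B: "finite B"
    "\<forall>z\<in>Z. \<exists>b\<in>span B. \<forall>f\<in>dual_space. fin_dim (rhit f ` Z) \<longrightarrow> f z = f b"
    by (rule cyclic_splitting[OF Z])
  have "Z \<subseteq> {b + y |b y. b \<in> span B \<and> y \<in> Y}"
  proof
    fix z
    assume "z \<in> Z"
    then obtain b where b: "b \<in> span B" "\<forall>f\<in>dual_space. fin_dim (rhit f ` Z) \<longrightarrow> f z = f b"
      using B(2) by blast
    have "z - b \<in> Y"
    proof (rule ccontr)
      assume "z - b \<notin> Y"
      then obtain f where "f \<in> dual_space" "fin_dim (rhit f ` Z)" "f (z - b) \<noteq> 0"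
        using sep by blast
      then show False
        using b(2) by (simp add: dual_diff)
    qed
    moreover have "z = b + (z - b)"
      by simp
    ultimately show "z \<in> {b + y |b y. b \<in> span B \<and> y \<in> Y}"
      using b(1) by blast
  qed
  then show ?thesis
    using fin_dim_mono fin_dim_sums[OF fin_dim_span_finite[OF B(1)] Y] by blast
qed

text \<open>Otherwise finite dimensional left submodules can be adjoined forever, giving an infinite
  direct sum \<open>Z\<close>. A functional that kills all summands after some stage has finite
  dimensional \<open>rhit\<close>-image on \<open>Z\<close>, and such functionals separate points,
  so \<open>Z\<close> would be finite dimensional.\<close>

lemma ex_essential:
  "\<exists>Y. fin_dim Y \<and> lsub Y \<and> (\<forall>W. lsub W \<longrightarrow> W \<noteq> {0} \<longrightarrow> W \<inter> Y \<noteq> {0})"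
proof (rule ccontr)
  assume no: "\<not> ?thesis"
  have ex: "\<exists>W. fin_dim W \<and> lsub W \<and> W \<noteq> {0} \<and> W \<inter> Y = {0}" if Y: "fin_dim Y" "lsub Y" for Y
  proof -
    obtain W where W: "lsub W" "W \<noteq> {0}" "W \<inter> Y = {0}"
      using no Y by blast
    then obtain w where w: "w \<in> W" "w \<noteq> 0"
      using subspace_0[OF lsub_subspace[OF W(1)]] by blast
    let ?O = "{lhit h w |h. h \<in> dual_space}"
    have "?O \<subseteq> W"
      using lsubD[OF W(1)] w(1) by blast
    moreover have "0 \<in> ?O"
      by (rule subspace_0[OF lsub_subspace[OF lsub_lorbit]])
    moreover have "0 \<in> Y"
      by (rule subspace_0[OF lsub_subspace[OF Y(2)]])
    ultimately have "?O \<inter> Y = {0}"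
      using W(3) by blast
    moreover have "?O \<noteq> {0}"
      using lorbit_self[of w] w(2) by blast
    ultimately show ?thesis
      using fin_dim_lorbit lsub_lorbit by blast
  qed
  have "\<forall>Y. \<exists>W. fin_dim Y \<and> lsub Y \<longrightarrow> fin_dim W \<and> lsub W \<and> W \<noteq> {0} \<and> W \<inter> Y = {0}"
    using ex by blast
  from choice[OF this] obtain W where
    W: "\<And>Y. fin_dim Y \<Longrightarrow> lsub Y \<Longrightarrow> fin_dim (W Y) \<and> lsub (W Y) \<and> W Y \<noteq> {0} \<and> W Y \<inter> Y = {0}"
    by blast
  define Y where "Y = rec_nat {0} (\<lambda>_ Y. {y + w |y w. y \<in> Y \<and> w \<in> W Y})"
  have Y0: "Y 0 = {0}" and YS: "Y (Suc n) = {y + w |y w. y \<in> Y n \<and> w \<in> W (Y n)}" for n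
    by (simp_all add: Y_def)
  have Y: "fin_dim (Y n) \<and> lsub (Y n)" for n
  proof (induction n)
    case 0
    then show ?case
      using fin_dim_span_finite[of "{}"] lsub_zero by (simp add: Y0)
  next
    case (Suc n)
    then show ?case
      using W[of "Y n"] by (simp add: YS fin_dim_sums lsub_sums)
  qed
  note finY = conjunct1[OF Y] and lY = conjunct2[OF Y]
  have WY: "fin_dim (W (Y n))" "lsub (W (Y n))" "W (Y n) \<noteq> {0}" "W (Y n) \<inter> Y n = {0}" for n
    using W[OF finY lY, of n] by simp_all
  have W0: "0 \<in> W (Y n)" and Yz: "0 \<in> Y n" for n
    using subspace_0[OF lsub_subspace[OF WY(2)]] subspace_0[OF lsub_subspace[OF lY]] by blast+
  have incY: "incseq Y"
  proof (rule incseq_SucI)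
    fix n
    have "y = y + 0" for y :: 'c
      by simp
    then show "Y n \<subseteq> Y (Suc n)"
      using W0[of n] unfolding YS by blast
  qed
  have W_le: "W (Y n) \<subseteq> Y (Suc n)" for n
  proof -
    have "w = 0 + w" for w :: 'c
      by simp
    then show ?thesis
      using Yz[of n] unfolding YS by blast
  qed
  \<comment> \<open>\<open>V n m\<close> is the sum of the \<open>m\<close> summands adjoined after
    stage \<open>n\<close>; the union over \<open>m\<close> is a complement of \<open>Y n\<close> in
    the union of all stages.\<close>
  define V where "V n = rec_nat {0} (\<lambda>m V. {v + w |v w. v \<in> V \<and> w \<in> W (Y (n + m))})" for n
  have V0: "V n 0 = {0}"
    and VS: "V n (Suc m) = {v + w |v w. v \<in> V n m \<and> w \<in> W (Y (n + m))}" for n m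
    by (simp_all add: V_def)
  have lV: "lsub (V n m)" for n m
    by (induction m) (simp_all add: V0 VS lsub_zero lsub_sums WY)
  have incV: "incseq (V n)" for n
  proof (rule incseq_SucI)
    fix m
    have "v = v + 0" for v :: 'c
      by simp
    then show "V n m \<subseteq> V n (Suc m)"
      using W0[of "n + m"] unfolding VS by blast
  qed
  have V_le: "V n m \<subseteq> Y (n + m)" for n m
  proof (induction m)
    case (Suc m)
    have "v + w \<in> Y (Suc (n + m))" if "v \<in> V n m" "w \<in> W (Y (n + m))" for v w
      using that Suc incseq_SucD[OF incY, of "n + m"] W_le[of "n + m"]
      by (intro subspace_add[OF lsub_subspace[OF lY]]) auto
    then show ?case
      by (auto simp: VS)
  qed (simp add: V0 Yz)
  have V_disj: "v = 0" if "v \<in> V n m" "v \<in> Y n" for n m v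
    using that
  proof (induction m arbitrary: v)
    case (Suc m)
    then obtain u w where uw: "v = u + w" "u \<in> V n m" "w \<in> W (Y (n + m))"
      by (auto simp: VS)
    have "v \<in> Y (n + m)"
      using Suc.prems(2) incseqD[OF incY, of n "n + m"] by auto
    then have "v - u \<in> Y (n + m)"
      using V_le[of n m] uw(2) by (intro subspace_diff[OF lsub_subspace[OF lY]]) auto
    then have "w = 0"
      using uw WY(4)[of "n + m"] by auto
    then show ?case
      using uw Suc by simp
  qed (simp add: V0)
  have Y_le: "\<exists>y\<in>Y n. \<exists>v\<in>V n m. z = y + v" if "z \<in> Y (n + m)" for n m z
    using that
  proof (induction m arbitrary: z)
    case (Suc m)
    then obtain z' w where z': "z = z' + w" "z' \<in> Y (n + m)" "w \<in> W (Y (n + m))"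
      by (auto simp: YS)
    then obtain y v where yv: "y \<in> Y n" "v \<in> V n m" "z' = y + v"
      using Suc.IH by blast
    then have "v + w \<in> V n (Suc m)"
      using z'(3) by (auto simp: VS)
    then show ?case
      using yv z'(1) by (metis add.assoc)
  qed (auto simp: V0)
  define Z where "Z = (\<Union>n. Y n)"
  have lZ: "lsub Z"
    unfolding Z_def by (rule lsub_UN_chain[OF incY lY])
  have "\<exists>f\<in>dual_space. fin_dim (rhit f ` Z) \<and> f z \<noteq> 0" if z: "z \<notin> {0}" for z
  proof (cases "z \<in> Z")
    case False
    then obtain f where f: "f \<in> ann Z" "f z = 1"
      using ann_separates[OF lsub_subspace[OF lZ]] by blast
    have "rhit f ` Z \<subseteq> span {}"
      using rhit_ann_lsub[OF lZ f(1)] by auto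
    then have "fin_dim (rhit f ` Z)"
      unfolding fin_dim_def by blast
    then show ?thesis
      using f ann_dual by (intro bexI[of _ f]) auto
  next
    case True
    then obtain n where n: "z \<in> Y n"
      by (auto simp: Z_def)
    have lVn: "lsub (\<Union>m. V n m)"
      by (rule lsub_UN_chain[OF incV lV])
    have "z \<notin> (\<Union>m. V n m)"
      using V_disj n z by auto
    then obtain f where f: "f \<in> ann (\<Union>m. V n m)" "f z = 1"
      using ann_separates[OF lsub_subspace[OF lVn]] by blast
    \<comment> \<open>\<open>f\<close> kills a left submodule, so \<open>rhit f\<close> kills it
      too, and only the finite dimensional \<open>Y n\<close> contributes.\<close>
    have "rhit f ` Z \<subseteq> rhit f ` Y n"
    proof
      fix x
      assume "x \<in> rhit f ` Z"
      then obtain m u where u: "x = rhit f u" "u \<in> Y m"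
        by (auto simp: Z_def)
      then have "u \<in> Y (n + m)"
        using incseqD[OF incY, of m "n + m"] by auto
      then obtain y v where yv: "y \<in> Y n" "v \<in> V n m" "u = y + v"
        using Y_le by blast
      have "rhit f v = 0"
        by (rule rhit_ann_lsub[OF lVn f(1)]) (use yv in blast)
      then show "x \<in> rhit f ` Y n"
        using u yv ann_dual[OF f(1)] by (simp add: rhit_add)
    qed
    then have "fin_dim (rhit f ` Z)"
      using fin_dim_mono fin_dim_image[OF finY linear_rhit[OF ann_dual[OF f(1)]]] by blast
    then show ?thesis
      using f ann_dual by (intro bexI[of _ f]) auto
  qed
  then have "fin_dim Z"
    using fin_dim_if_separated[OF lZ, of "{0}"] fin_dim_span_finite[of "{}"] by simp
  then obtain n where n: "Z \<subseteq> Y n"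
    using fin_dim_subset_chain[OF incY lsub_subspace[OF lY] _ lsub_subspace[OF lZ]] Z_def by blast
  have "W (Y n) \<subseteq> Y n"
    using W_le[of n] n unfolding Z_def by blast
  then show False
    using WY(3,4)[of n] by blast
qed

text \<open>Take the span of the \<open>rhit\<close>-orbits of a basis of the essential
  \<open>Y\<close>: the orbits are finite dimensional, the counit puts \<open>Y\<close> into their
  span, and commuting actions keep it stable under \<open>lhit\<close>.\<close>

lemma ex_essential_subcoalgebra:
  obtains D where "fin_dim D" "lsub D" "rsub D" "\<forall>W. lsub W \<longrightarrow> W \<noteq> {0} \<longrightarrow> W \<inter> D \<noteq> {0}"
proof -
  obtain Y where Y: "fin_dim Y" "lsub Y" "\<forall>W. lsub W \<longrightarrow> W \<noteq> {0} \<longrightarrow> W \<inter> Y \<noteq> {0}"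
    using ex_essential by blast
  obtain B where B: "finite B" "span B = Y"
    using fin_dim_basis[OF Y(1) lsub_subspace[OF Y(2)]] by blast
  define S where "S = (\<Union>b\<in>B. {rhit f b |f. f \<in> dual_space})"
  define D where "D = span S"
  have "fin_dim D"
    unfolding D_def S_def by (intro fin_dim_span fin_dim_UN B(1) fin_dim_rorbit)
  moreover have YD: "rhit f y \<in> D" if "f \<in> dual_space" "y \<in> Y" for f y
  proof (rule linear_span_in[OF linear_rhit[OF that(1)]])
    show "y \<in> span B"
      using that B by simp
    show "rhit f b \<in> D" if "b \<in> B" for b
      unfolding D_def S_def by (rule span_base) (use that \<open>f \<in> dual_space\<close> in blast)
  qed (simp add: D_def)
  moreover have "lsub D"
    unfolding lsub_def
  proof (intro conjI ballI)
    fix h c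
    assume h: "h \<in> dual_space" and c: "c \<in> D"
    show "lhit h c \<in> D"
    proof (rule linear_span_in[OF linear_lhit[OF h]])
      show "c \<in> span S"
        using c by (simp add: D_def)
      fix s
      assume "s \<in> S"
      then obtain b f where "b \<in> B" "f \<in> dual_space" "s = rhit f b"
        by (auto simp: S_def)
      moreover have "lhit h b \<in> Y"
        using lsubD[OF Y(2) h] \<open>b \<in> B\<close> B(2) span_base by blast
      ultimately show "lhit h s \<in> D"
        using YD h by (simp add: lhit_rhit_commute)
    qed (simp add: D_def)
  qed (simp add: D_def)
  moreover have "rsub D"
    unfolding rsub_def
  proof (intro conjI ballI)
    fix h c
    assume h: "h \<in> dual_space" and c: "c \<in> D"
    show "rhit h c \<in> D"
    proof (rule linear_span_in[OF linear_rhit[OF h]])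
      show "c \<in> span S"
        using c by (simp add: D_def)
      fix s
      assume "s \<in> S"
      then obtain b f where "b \<in> B" "f \<in> dual_space" "s = rhit f b"
        by (auto simp: S_def)
      moreover have "b \<in> Y"
        using \<open>b \<in> B\<close> B(2) span_base by blast
      ultimately show "rhit h s \<in> D"
        using YD[of "conv f h" b] h by (simp add: rhit_conv conv_dual)
    qed (simp add: D_def)
  qed (simp add: D_def)
  moreover have "Y \<subseteq> D"
    using YD[OF counit_dual] by (auto simp: rhit_counit)
  then have "\<forall>W. lsub W \<longrightarrow> W \<noteq> {0} \<longrightarrow> W \<inter> D \<noteq> {0}"
    using Y(3) subspace_0[OF lsub_subspace[OF Y(2)]] subspace_0[OF lsub_subspace] by blast
  ultimately show thesis
    using that by blast
qed

text \<open>If \<open>f\<close> kills \<open>wedge D n\<close>, then \<open>rhit f\<close> maps the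
  next wedge power into \<open>D\<close>: \<open>lhit h\<close> with \<open>h\<close> in
  \<open>ann D\<close> lands in \<open>wedge D n\<close>, where \<open>rhit f\<close> vanishes. So
  these \<open>f\<close> separate as \<open>fin_dim_if_separated\<close> demands.\<close>

lemma fin_dim_wedge:
  assumes "fin_dim D" "lsub D" "rsub D"
  shows "fin_dim (wedge D n)"
proof (induction n)
  case 0
  then show ?case
    using fin_dim_span_finite[of "{}"] by simp
next
  case (Suc n)
  show ?case
  proof (rule fin_dim_if_separated[OF lsub_wedge[OF assms(2,3)] Suc])
    fix v
    assume "v \<notin> wedge D n"
    then obtain f where f: "f \<in> ann (wedge D n)" "f v = 1"
      using ann_separates[OF subspace_wedge] by blast
    note fd = ann_dual[OF f(1)]
    have "rhit f c \<in> D" if c: "c \<in> wedge D (Suc n)" for c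
    proof -
      have "lhit h (rhit f c) = 0" if h: "h \<in> ann D" for h
        using c h rhit_ann_lsub[OF lsub_wedge[OF assms(2,3)] f(1)]
        by (simp add: lhit_rhit_commute[OF fd ann_dual[OF h]])
      then show ?thesis
        using wedge_1[OF assms(2,3)] by auto
    qed
    then have "fin_dim (rhit f ` wedge D (Suc n))"
      by (intro fin_dim_mono[OF assms(1)]) auto
    then show "\<exists>f\<in>dual_space. fin_dim (rhit f ` wedge D (Suc n)) \<and> f v \<noteq> 0"
      using f fd by (intro bexI[of _ f]) auto
  qed
qed

text \<open>If all products vanished, \<open>rhit f\<close> would map \<open>C\<close> into
  \<open>S\<close> for each \<open>f\<close> in \<open>ann S\<close>; these functionals detect
  everything outside \<open>S\<close>, so \<open>C\<close> would be finite dimensional.\<close>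

lemma ex_nonzero_product:
  assumes "\<not> fin_dim UNIV" "fin_dim S" "subspace S"
  shows "\<exists>f\<in>ann S. \<exists>g\<in>ann S. \<exists>c. f (lhit g c) \<noteq> 0"
proof (rule ccontr)
  assume *: "\<not> ?thesis"
  have "fin_dim UNIV"
  proof (rule fin_dim_if_separated[OF lsub_UNIV assms(2)])
    fix v
    assume "v \<notin> S"
    then obtain f where f: "f \<in> ann S" "f v = 1"
      using ann_separates[OF assms(3)] by blast
    have "rhit f c \<in> S" for c
    proof (rule ccontr)
      assume "rhit f c \<notin> S"
      then obtain g where g: "g \<in> ann S" "g (rhit f c) = 1"
        using ann_separates[OF assms(3)] by blast
      then show False
        using * f(1) pairing[OF ann_dual[OF f(1)] ann_dual[OF g(1)], of c] by auto
    qed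
    then have "fin_dim (rhit f ` UNIV)"
      by (intro fin_dim_mono[OF assms(2)]) auto
    then show "\<exists>f\<in>dual_space. fin_dim (rhit f ` UNIV) \<and> f v \<noteq> 0"
      using f ann_dual by (intro bexI[of _ f]) auto
  qed
  then show False
    using assms(1) by simp
qed

section \<open>The infinite product module and the contradiction\<close>

theorem fin_dim_UNIV: "fin_dim UNIV"
proof (rule ccontr)
  assume inf: "\<not> fin_dim UNIV"
  obtain D where D: "fin_dim D" "lsub D" "rsub D"
    and ess: "\<forall>W. lsub W \<longrightarrow> W \<noteq> {0} \<longrightarrow> W \<inter> D \<noteq> {0}"
    by (rule ex_essential_subcoalgebra)
  note lD = D(2,3)
  note lsubW = lsub_wedge[OF lD] and rsubW = rsub_wedge[OF lD] and incW = incseq_wedge[OF lD]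
    and finW = fin_dim_wedge[OF D]
  have exh: "(\<Union>n. wedge D n) = UNIV"
    using wedge_exhausts[OF lD] ess by blast
  obtain G where G: "finite G" "G \<subseteq> ann D" and
    gen: "\<forall>h\<in>ann D. \<exists>a. (\<forall>g\<in>G. a g \<in> dual_space) \<and> (\<forall>z. h z = (\<Sum>g\<in>G. a g (lhit g z)))"
    by (rule generators[OF lD finW exh])
  have wedge: "wedge D n = {c. \<forall>w\<in>words G n. lhit w c = 0}" for n
    by (rule wedge_eq_words[OF lD G gen])
  have wd: "w \<in> dual_space" if "w \<in> words G n" for w n
    using words_dual[of G n] G(2) ann_dual that by blast
  have "\<forall>n. \<exists>p. fst p \<in> ann (wedge D n) \<and> fst (snd p) \<in> ann (wedge D n) \<and>
      fst p (lhit (fst (snd p)) (snd (snd p))) \<noteq> 0"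
  proof
    fix n
    obtain f g c where "f \<in> ann (wedge D n)" "g \<in> ann (wedge D n)" "f (lhit g c) \<noteq> 0"
      using ex_nonzero_product[OF inf finW subspace_wedge] by blast
    then show "\<exists>p. fst p \<in> ann (wedge D n) \<and> fst (snd p) \<in> ann (wedge D n) \<and>
        fst p (lhit (fst (snd p)) (snd (snd p))) \<noteq> 0"
      by (intro exI[of _ "(f, g, c)"]) simp
  qed
  from choice[OF this] obtain p where p: "\<And>n. fst (p n) \<in> ann (wedge D n)"
    "\<And>n. fst (snd (p n)) \<in> ann (wedge D n)"
    "\<And>n. fst (p n) (lhit (fst (snd (p n))) (snd (snd (p n)))) \<noteq> 0"
    by blast
  define x y c where "x n = fst (p n)" and "y n = fst (snd (p n))" and "c n = snd (snd (p n))" for n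
  have x: "x n \<in> ann (wedge D n)" and y: "y n \<in> ann (wedge D n)" and xyc: "x n (lhit (y n) (c n)) \<noteq> 0"
    for n
    using p by (simp_all add: x_def y_def c_def)
  \<comment> \<open>The dual of the wedge power containing \<open>c n\<close> will be the
    \<open>n\<close>-th factor of the product, so that the product of \<open>x n\<close> and
    \<open>y n\<close> remains nonzero there.\<close>
  have "\<forall>n. \<exists>m. c n \<in> wedge D m"
    using exh by blast
  from choice[OF this] obtain m where m: "\<And>n. c n \<in> wedge D (m n)"
    by blast
  \<comment> \<open>The index type of the families must contain a copy of the natural numbers. It is
    infinite because \<open>C\<close> is, and indicator functions embed \<open>C\<close> into
    it.\<close>
  have "infinite (UNIV :: 'c set)"
    using inf span_superset[of UNIV] unfolding fin_dim_def by blast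
  moreover have "inj (\<lambda>a b :: 'c. if b = a then 1 else (0 :: 'k))"
    by (rule injI) (metis zero_neq_one)
  ultimately have "infinite (UNIV :: ('c \<Rightarrow> 'k) set)"
    using finite_imageD[of "\<lambda>a b :: 'c. if b = a then 1 else (0 :: 'k)" UNIV] finite_subset[OF subset_UNIV]
    by blast
  then obtain \<iota> :: "nat \<Rightarrow> 'c \<Rightarrow> 'k" where \<iota>: "inj \<iota>"
    using infinite_countable_subset by blast
  define fam :: "(nat \<Rightarrow> 'c \<Rightarrow> 'k) \<Rightarrow> ('c \<Rightarrow> 'k) \<Rightarrow> 'c \<Rightarrow> 'k"
    where "fam u = (\<lambda>i. if i \<in> range \<iota> then u (inv_into UNIV \<iota> i) else 0)" for u
  have fam_apply: "fam u (\<iota> n) = u n" for u n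
    using \<iota> by (simp add: fam_def)
  have fam_families: "fam u \<in> families" if "\<And>n. u n \<in> dual_space" for u
    using that dual_closed(4) by (simp add: families_def fam_def)
  \<comment> \<open>Components outside the range of \<open>\<iota>\<close> are unconstrained and
    vanish in the quotient, which is thus the product over \<open>n\<close> of the dual algebra
    modulo \<open>ann (wedge D (m n))\<close>.\<close>
  define N where "N = {F \<in> families. \<forall>n. \<forall>z\<in>wedge D (m n). F (\<iota> n) z = 0}"
  have N: "subfam N"
    using lsubD[OF lsubW]
    by (auto simp: N_def subfam_def families_closed act_def families_def dual_closed conv_dual conv_eq_lhit)
  note ratN = subfam_rat(1)[OF N]
  obtain Q where Q: "subfam Q" "Q \<inter> rat N = N" and QT: "\<forall>F\<in>families. \<exists>q\<in>Q. \<exists>t\<in>rat N. F = q + t"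
    using split[OF N] by blast
  define X where "X = fam x"
  have X: "X \<in> families"
    unfolding X_def by (rule fam_families) (rule ann_dual[OF x])
  obtain q t where q: "q \<in> Q" and t: "t \<in> rat N" and Xqt: "X = q + t"
    using QT X by blast
  \<comment> \<open>This gives \<open>q \<in> N\<close>. Words of length \<open>m n0\<close>
    annihilate the \<open>n0\<close>-th factor, so it suffices that, up to \<open>N\<close>,
    \<open>q\<close> is a sum of elements of \<open>Q\<close> multiplied by such words.\<close>
  have "q (\<iota> n0) z = 0" if z: "z \<in> wedge D (m n0)" for n0 z
  proof -
    define k where "k = m n0"
    let ?W = "words G k"
    have finite_W: "finite ?W"
      by (rule finite_words[OF G(1)])
    \<comment> \<open>For \<open>n \<ge> k\<close> the functional \<open>x n\<close> kills
      \<open>wedge D n\<close>, hence \<open>wedge D k\<close>, which is the common kernel of the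
      words.\<close>
    have "\<exists>a. (\<forall>w\<in>?W. a w \<in> dual_space) \<and> (\<forall>z. x n z = (\<Sum>w\<in>?W. a w (lhit w z)))" if "n \<ge> k" for n
    proof (rule factor_functional_finite[OF finite_W ann_dual[OF x]])
      show "Vector_Spaces.linear scale scale (lhit w)" if "w \<in> ?W" for w
        by (rule linear_lhit[OF wd[OF that]])
      fix z
      assume "\<And>w. w \<in> ?W \<Longrightarrow> lhit w z = 0"
      then have "z \<in> wedge D k"
        using wedge by blast
      then show "x n z = 0"
        using annD[OF x] incseqD[OF incW \<open>n \<ge> k\<close>] by blast
    qed
    then have "\<forall>n. \<exists>a. n \<ge> k \<longrightarrow> (\<forall>w\<in>?W. a w \<in> dual_space) \<and> (\<forall>z. x n z = (\<Sum>w\<in>?W. a w (lhit w z)))"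
      by blast
    from choice[OF this] obtain a where
      a: "\<And>n. n \<ge> k \<Longrightarrow> (\<forall>w\<in>?W. a n w \<in> dual_space) \<and> (\<forall>z. x n z = (\<Sum>w\<in>?W. a n w (lhit w z)))"
      by blast
    define Y where "Y w = fam (\<lambda>n. if n \<ge> k then a n w else 0)" for w
    have Y: "Y w \<in> families" if "w \<in> ?W" for w
      unfolding Y_def by (rule fam_families) (use a that dual_closed(4) in auto)
    \<comment> \<open>The tail of \<open>X\<close> is the sum of the \<open>act (Y w) w\<close>, so
      \<open>X'\<close> is \<open>X\<close> truncated to the components below
      \<open>k\<close>.\<close>
    define X' where "X' = X - (\<Sum>w\<in>?W. act (Y w) w)"
    have X'_apply: "X' (\<iota> n) = (if n < k then x n else 0)" for n
    proof (intro ext)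
      fix z
      have eq: "X' (\<iota> n) z = x n z - (\<Sum>w\<in>?W. conv (if n \<ge> k then a n w else 0) w z)"
        by (simp add: X'_def X_def Y_def act_def sum_fun_apply fam_apply)
      show "X' (\<iota> n) z = (if n < k then x n else 0) z"
      proof (cases "n < k")
        case True
        then show ?thesis
          unfolding eq by (simp add: conv_eq_lhit dual_closed(4))
      next
        case False
        then have "(\<Sum>w\<in>?W. conv (if n \<ge> k then a n w else 0) w z) = (\<Sum>w\<in>?W. a n w (lhit w z))"
          using a[of n] by (intro sum.cong refl) (simp add: conv_eq_lhit)
        then show ?thesis
          unfolding eq using False a[of n] by simp
      qed
    qed
    have X'_fam: "X' \<in> families"
      unfolding X'_def
      using X Y wd families_closed(3)
      by (intro subfam_minus[OF subfam_families] subfam_sum[OF subfam_families]) blast+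
    \<comment> \<open>For \<open>v\<close> in \<open>wedge D (m n)\<close> also
      \<open>rhit (x n) v\<close> stays there, so a finite set whose span contains these finitely
      many wedge powers witnesses rationality of \<open>X'\<close>.\<close>
    have "fin_dim (\<Union>n\<in>{..<k}. wedge D (m n))"
      by (rule fin_dim_UN) (simp_all add: finW)
    then obtain B where B: "finite B" "(\<Union>n\<in>{..<k}. wedge D (m n)) \<subseteq> span B"
      by (auto simp: fin_dim_def)
    have "act X' h \<in> N" if h: "h \<in> ann B" for h
    proof -
      have "conv (X' (\<iota> n)) h v = 0" if v: "v \<in> wedge D (m n)" for n v
      proof (cases "n < k")
        case True
        have "rhit (x n) v \<in> span B"
          using B(2) True rsubD[OF rsubW ann_dual[OF x] v] by blast
        moreover have "h \<in> ann (span B)"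
          using h ann_span by blast
        ultimately show ?thesis
          using True annD ann_dual[OF h] by (simp add: X'_apply conv_eq_rhit)
      next
        case False
        then show ?thesis
          by (simp add: X'_apply conv_eq_lhit dual_closed(4))
      qed
      then show ?thesis
        using families_closed(3)[OF X'_fam ann_dual[OF h]] by (simp add: N_def act_def)
    qed
    then have X'_rat: "X' \<in> rat N"
      using X'_fam B(1) by (auto simp: rat_def)
    have "\<forall>w\<in>?W. \<exists>r. fst r \<in> Q \<and> snd r \<in> rat N \<and> Y w = fst r + snd r"
    proof
      fix w
      assume "w \<in> ?W"
      then obtain q' t' where "q' \<in> Q" "t' \<in> rat N" "Y w = q' + t'"
        using QT Y by blast
      then show "\<exists>r. fst r \<in> Q \<and> snd r \<in> rat N \<and> Y w = fst r + snd r"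
        by (intro exI[of _ "(q', t')"]) simp
    qed
    from bchoice[OF this] obtain r where
      r: "\<forall>w\<in>?W. fst (r w) \<in> Q \<and> snd (r w) \<in> rat N \<and> Y w = fst (r w) + snd (r w)"
      by blast
    define q' t' where "q' w = fst (r w)" and "t' w = snd (r w)" for w
    have q': "q' w \<in> Q" and t': "t' w \<in> rat N" and Y_eq: "Y w = q' w + t' w" if "w \<in> ?W" for w
      using r that by (simp_all add: q'_def t'_def)
    \<comment> \<open>Comparison of \<open>Q\<close>-components: \<open>s\<close> is in
      \<open>Q\<close> by construction, and rewriting \<open>q\<close> as \<open>X - t\<close> and
      splitting each \<open>Y w\<close> shows that it is rational, hence in
      \<open>N\<close>.\<close>
    define s where "s = q - (\<Sum>w\<in>?W. act (q' w) w)"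
    have "s \<in> Q"
      unfolding s_def using q' wd subfamD(4)[OF Q(1)]
      by (intro subfam_minus[OF Q(1) q] subfam_sum[OF Q(1)]) blast
    moreover have "s \<in> rat N"
    proof -
      have "(\<Sum>w\<in>?W. act (Y w) w) = (\<Sum>w\<in>?W. act (q' w) w + act (t' w) w)"
      proof (rule sum.cong[OF refl])
        fix w
        assume w: "w \<in> ?W"
        show "act (Y w) w = act (q' w) w + act (t' w) w"
          unfolding Y_eq[OF w]
          by (rule act_add_left[OF subfamD(1)[OF Q(1) q'[OF w]] subfamD(1)[OF ratN t'[OF w]]])
      qed
      also have "\<dots> = (\<Sum>w\<in>?W. act (q' w) w) + (\<Sum>w\<in>?W. act (t' w) w)"
        by (rule sum.distrib)
      finally have sum_eq: "(\<Sum>w\<in>?W. act (Y w) w)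
        = (\<Sum>w\<in>?W. act (q' w) w) + (\<Sum>w\<in>?W. act (t' w) w)" .
      have "s = X' - t + (\<Sum>w\<in>?W. act (t' w) w)"
        unfolding s_def X'_def Xqt sum_eq by (simp add: algebra_simps)
      also have "\<dots> \<in> rat N"
        using t' wd subfamD(4)[OF ratN]
        by (intro subfamD(3)[OF ratN] subfam_minus[OF ratN X'_rat t] subfam_sum[OF ratN]) blast
      finally show ?thesis .
    qed
    ultimately have "s \<in> N"
      using Q(2) by blast
    then have "s (\<iota> n0) z = 0"
      using z by (simp add: N_def)
    moreover have "act (q' w) w (\<iota> n0) z = 0" if w: "w \<in> ?W" for w
    proof -
      have "lhit w z = 0"
        using z w wedge unfolding k_def by blast
      then show ?thesis
        using familiesD[OF subfamD(1)[OF Q(1) q'[OF w]]] by (simp add: act_def conv_eq_lhit dual_0)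
    qed
    ultimately show ?thesis
      by (simp add: s_def sum_fun_apply)
  qed
  then have "q \<in> N"
    using subfamD(1)[OF Q(1) q] by (simp add: N_def)
  then have "X \<in> rat N"
    unfolding Xqt using t subfam_rat(2)[OF N] subfamD(3)[OF ratN] by blast
  then obtain B where B: "finite B" "\<forall>h\<in>ann B. act X h \<in> N"
    by (auto simp: rat_def)
  \<comment> \<open>A finite \<open>B\<close> already lies in some \<open>wedge D j\<close>, which
    \<open>y j\<close> kills. Rationality of \<open>X\<close> then makes the product of
    \<open>x j\<close> and \<open>y j\<close> vanish at \<open>c j\<close>, against the choice of
    \<open>c j\<close>.\<close>
  obtain j where j: "span B \<subseteq> wedge D j"
    by (rule fin_dim_subset_chain[OF incW subspace_wedge fin_dim_span_finite[OF B(1)] subspace_span])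
      (use exh in auto)
  have "y j \<in> ann B"
    using y[of j] ann_mono[OF j] ann_span[of B] by blast
  then have "act X (y j) \<in> N"
    using B(2) by blast
  then have "act X (y j) (\<iota> j) (c j) = 0"
    using m[of j] by (simp add: N_def)
  then show False
    using xyc[of j] ann_dual[OF x] by (simp add: act_def X_def fam_apply conv_eq_lhit)
qed

end

theorem theorem1p5:
  fixes scale :: "'k::field \<Rightarrow> 'c::ab_group_add \<Rightarrow> 'c"
    and \<Delta> :: "'c \<Rightarrow> ('c \<times> 'c \<Rightarrow>\<^sub>0 'k) set"
    and \<epsilon> :: "'c \<Rightarrow> 'k"
  assumes "coalgebra scale \<Delta> \<epsilon>"
    and "\<And>M :: ('c \<Rightarrow> 'k, (('c \<Rightarrow> 'k) \<Rightarrow> 'c \<Rightarrow> 'k) set) right_mod.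
           right_module (dual_algebra scale \<Delta> \<epsilon>) M \<Longrightarrow>
           direct_summand (dual_algebra scale \<Delta> \<epsilon>) M (rational_part scale \<Delta> \<epsilon> M)"
  shows "\<exists>B. finite_dimensional_vector_space scale B"
proof -
  interpret coalgebra scale \<Delta> \<epsilon> by fact
  interpret splitting_coalgebra scale \<Delta> \<epsilon>
  proof
    fix N :: "(('c \<Rightarrow> 'k) \<Rightarrow> 'c \<Rightarrow> 'k) set"
    assume N: "subfam N"
    \<comment> \<open>The hypothesis is applied to the modules \<open>quotient N\<close>, and the
      complement is pulled back to families.\<close>
    show "\<exists>Q. subfam Q \<and> Q \<inter> rat N = N \<and> (\<forall>F\<in>families. \<exists>q\<in>Q. \<exists>t\<in>rat N. F = q + t)"
      by (rule complement_of_rat[OF N assms(2)[OF right_module_quotient[OF N]]]) blast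
  qed
  obtain B where "finite B" "independent B" "span B = UNIV"
    by (rule fin_dim_basis[OF fin_dim_UNIV subspace_UNIV])
  then have "finite_dimensional_vector_space scale B"
    by unfold_locales
  then show ?thesis ..
qed

end
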